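(* For all integers $n\ge 0$, $\alpha\ge 0$, $\beta\ge 0$ and every odd prime $p$: $$v_0(2^{2\alpha+2}p^{2\beta+1}(8pn+8i+p))\equiv 0 \pmod{2^{3\alpha+9}}\quad\text{for every } i\in\{1,2,3,\ldots,p-1\},$$ and $$v_0(2^{2\alpha+2}p^{2\beta}(8pn+8j+1))\equiv 0 \pmod{2^{3\alpha+9}}$$ for every integer $j$ with $0\le j\le p-1$ such that the Legendre symbol satisfies $\left(\frac{8j+1}{p}\right)=-1$.
   Context: The integer sequence $v_0(n)$, $n\ge 0$, is defined by the generating function (formal power series in $q$) $$\sum_{n=0}^\infty v_0(n)q^n=\sum_{n=0}^\infty \frac{q^{n^2}(-q;q^2)_n}{(q;q^2)_n},$$ where $(a;q)_0=1$ and $(a;q)_n=\prod_{i=1}^n(1-aq^{i-1})$ for $n\ge1$, so that $(-q;q^2)_n=\prod_{i=1}^n(1+q^{2i-1})$ and $(q;q^2)_n=\prod_{i=1}^n(1-q^{2i-1})$. *)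

theory Defs
  imports
    "HOL-Computational_Algebra.Formal_Power_Series"
    "HOL-Number_Theory.Residues"
begin

definition q_poch :: "'a::comm_ring_1 \<Rightarrow> 'a \<Rightarrow> nat \<Rightarrow> 'a" where
  "q_poch a q n = (\<Prod>i=1..n. 1 - a * q ^ (i - 1))"

text \<open>
  Series are taken over the integers, where power series division is not available. The
  denominator has constant coefficient 1 and is therefore a unit;
  \<open>fps_right_inverse f 1\<close> is its inverse (see \<open>q_poch_fps_X_inverse\<close>). The sum over \<open>n\<close> is the
  limit in the usual topology on formal power series (see \<open>summable_v0_term\<close>).
\<close>

definition v0_term :: "nat \<Rightarrow> int fps" where
  "v0_term n = fps_X ^ (n^2) * q_poch (- fps_X) (fps_X ^ 2) n
                 * fps_right_inverse (q_poch fps_X (fps_X ^ 2) n) 1"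

definition v0 :: "nat \<Rightarrow> int" where
  "v0 n = fps_nth (\<Sum>k. v0_term k) n"

lemma q_poch_fps_X_nth_0: "fps_nth (q_poch fps_X (fps_X ^ 2) n :: int fps) 0 = 1"
  by (induction n) (simp_all add: q_poch_def)

lemma q_poch_fps_X_inverse:
  fixes n :: nat
  defines "f \<equiv> (q_poch fps_X (fps_X ^ 2) n :: int fps)"
  shows "f * fps_right_inverse f 1 = 1"
  by (rule fps_right_inverse) (simp add: f_def q_poch_fps_X_nth_0)

lemma fps_nth_v0_term_eq_0:
  assumes "m < n"
  shows "fps_nth (v0_term n) m = 0"
proof -
  have "m < n^2" using assms by (simp add: power2_eq_square less_le_trans)
  thus ?thesis by (simp add: v0_term_def mult.assoc fps_X_power_mult_nth)
qed

lemma summable_v0_term: "summable v0_term"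
proof -
  define G where "G = Abs_fps (\<lambda>m. fps_nth (\<Sum>k\<le>m. v0_term k) m)"
  have "(\<lambda>N. \<Sum>k<N. v0_term k) \<longlonglongrightarrow> G"
  proof (rule tendsto_fpsI)
    fix m
    have "fps_nth (\<Sum>k<N. v0_term k) m = fps_nth G m" if "N > m" for N
    proof -
      have "(\<Sum>k<N. fps_nth (v0_term k) m) = (\<Sum>k\<le>m. fps_nth (v0_term k) m)"
        by (rule sum.mono_neutral_right) (use that fps_nth_v0_term_eq_0 in auto)
      thus ?thesis by (simp add: G_def fps_sum_nth)
    qed
    thus "\<forall>\<^sub>F N in sequentially. fps_nth (\<Sum>k<N. v0_term k) m = fps_nth G m"
      using eventually_gt_at_top[of m] by (rule eventually_mono[rotated])
  qed
  thus ?thesis unfolding summable_def sums_def by blast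
qed

end

theory Submission
  imports Defs
begin

text \<open>
  Write \<open>\<theta>(q) = \<Sum> q^(n^2)\<close> over all integers \<open>n\<close>. Adding to the generating function of
  \<open>v0\<close> its image under \<open>q \<mapsto> -q\<close> gives a bilateral, well-poised series, which sums to a
  product; with Gauss' product for \<open>\<theta>(-q)\<close> this yields
  \<open>2 \<Sum> v0(4n) q^n - 1 = \<theta>(q)^2 / \<theta>(-q)\<close>.

  Let \<open>A = \<theta>(q^4)\<close> and \<open>\<theta>(q) = A (1 + s)\<close>, so \<open>\<theta>(-q) = A (1 - s)\<close> and the series above is
  \<open>A (1 + s)^2 / (1 - s)\<close>. All exponents of \<open>s\<close> are 1 modulo 4, and \<open>s^4 = w(q^4)\<close> with
  \<open>w = 1 - \<theta>(-q)^4 / \<theta>(q)^4\<close>. Hence taking every fourth coefficient turns \<open>A P(s)\<close> into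
  \<open>\<theta>(q) P4(w)\<close>, where \<open>P4\<close> again consists of every fourth coefficient of \<open>P\<close>. As
  \<open>w = 8 s (1 + s^2) / (1 + s)^4\<close>, each iteration gains a factor 8 in front of everything but
  \<open>\<theta>(q)\<close> itself, whose coefficients vanish at nonsquares. Finally \<open>s\<close> is divisible by 2, and
  at nonsquares that are 1 modulo 8 every coefficient of \<open>A P(s)\<close> is divisible by \<open>2^8\<close>.
\<close>

subsection \<open>A telescoping sum\<close>

text \<open>\<open>t'\<close> is \<open>t\<close> with \<open>x\<close> replaced by
  \<open>x * r\<close>, which turns \<open>d i\<close> into \<open>d (Suc i)\<close>. The result is
  a first-order difference equation in \<open>x\<close> for the sums, with the truncation error kept
  as an explicit last term carrying \<open>r ^ M\<close>.\<close>

lemma telescoping_product_sum: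
  fixes r s x z \<nu> :: "'a :: comm_ring_1" and d :: "nat \<Rightarrow> 'a"
  defines "c \<equiv> \<nu> * z"
  defines "t \<equiv> (\<lambda>n. \<Prod>i<n. c * r ^ i * (x + z * r ^ i) * d i)"
    and "t' \<equiv> (\<lambda>n. \<Prod>i<n. c * r ^ i * (x * r + z * r ^ i) * d (Suc i))"
  assumes r: "r = z * s" and d: "\<And>i. (1 - x * c * r ^ i) * d i = 1"
  shows "(1 + \<nu> * r * x\<^sup>2) * (\<Sum>n\<le>M. t' n) - (1 - c * x) * (1 + s * x) * (\<Sum>n\<le>M. t n)
           = \<nu> * r * x\<^sup>2 - s * x + (1 - c * x) * (1 + s * x) * x * c * r ^ M * d M * t M"
proof (induction M)
  case 0
  have d0: "(1 - c * x) * d 0 = 1" using d[of 0] by (simp add: mult_ac)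
  have "(1 - c * x) * (1 + s * x) * x * c * r ^ 0 * d 0 * t 0
      = (1 + s * x) * x * c * ((1 - c * x) * d 0)"
    unfolding t_def by (simp add: mult_ac)
  thus ?case unfolding t_def t'_def unfolding d0 by (simp add: r c_def algebra_simps power2_eq_square)
next
  case (Suc M)
  \<comment> \<open>As \<open>r = z * s\<close>, the first factor \<open>x * r + z\<close> is
    \<open>z * (1 + s * x)\<close>, and each later one is \<open>r\<close> times a factor of
    \<open>t\<close>.\<close>
  have t'_Suc: "t' (Suc m) = t m * (c * r ^ m * z * (1 + s * x) * r ^ m * (1 - c * x) * d m * d (Suc m))" for m
  proof (induction m)
    case 0
    have d0: "(1 - c * x) * d 0 = 1" using d[of 0] by (simp add: mult_ac)
    have "c * (x * r + z) * d 1 = c * z * (1 + s * x) * ((1 - c * x) * d 0) * d 1"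
      unfolding d0 r by (simp add: algebra_simps)
    thus ?case unfolding t_def t'_def by (simp add: mult.assoc)
  next
    case (Suc m)
    have "t' (Suc (Suc m)) = t' (Suc m) * (c * r ^ Suc m * (x * r + z * r ^ Suc m) * d (Suc (Suc m)))"
      unfolding t'_def by simp
    also have "\<dots> = t (Suc m) * (c * r ^ Suc m * z * (1 + s * x) * r ^ Suc m * (1 - c * x) * d (Suc m) * d (Suc (Suc m)))"
      unfolding Suc unfolding t_def by (simp add: algebra_simps)
    finally show ?case .
  qed
  define y D D' where "y = r ^ M" "D = d M" "D' = d (Suc M)"
  have D': "(1 - x * c * y * r) * D' = 1" using d[of "Suc M"] by (simp add: y_D_D'_def mult_ac)
  have tS: "t (Suc M) = t M * (c * y * (x + z * y) * D)" by (simp add: t_def y_D_D'_def)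
  have t'S: "t' (Suc M) = t M * (c * y * z * (1 + s * x) * y * (1 - c * x) * D * D')"
    by (simp add: t'_Suc y_D_D'_def)
  \<comment> \<open>The last summand vanishes by \<open>D'\<close>. With it the equation is a ring
    identity in which \<open>D\<close> and \<open>D'\<close> are free variables; the other two
    summands telescope.\<close>
  have "(1 + \<nu> * r * x\<^sup>2) * t' (Suc M) - (1 - c * x) * (1 + s * x) * t (Suc M)
      = (1 - c * x) * (1 + s * x) * x * c * (y * r) * D' * t (Suc M)
         - (1 - c * x) * (1 + s * x) * x * c * y * D * t M
         + t M * c * y * (1 + s * x) * (1 - c * x) * D * (z * y) * ((1 - x * c * y * r) * D' - 1)"
    unfolding tS t'S by (simp add: algebra_simps power2_eq_square c_def)
  hence *: "(1 + \<nu> * r * x\<^sup>2) * t' (Suc M) - (1 - c * x) * (1 + s * x) * t (Suc M)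
      = (1 - c * x) * (1 + s * x) * x * c * r ^ Suc M * d (Suc M) * t (Suc M)
         - (1 - c * x) * (1 + s * x) * x * c * r ^ M * d M * t M"
    unfolding D' by (simp add: y_D_D'_def mult_ac)
  have "a * (S' + u') - b * (S + u) = (a * S' - b * S) + (a * u' - b * u)" for a b S S' u u' :: 'a
    by (simp add: algebra_simps)
  thus ?case using Suc * by simp
qed

subsection \<open>Congruences modulo a power of X\<close>

text \<open>Stated by divisibility so that compatibility with the ring operations is plain algebra;
  \<open>fps_cong_iff_nth\<close> translates it to coefficients.\<close>

definition fps_cong :: "nat \<Rightarrow> 'a::comm_ring_1 fps \<Rightarrow> 'a fps \<Rightarrow> bool" where
  "fps_cong M f g \<longleftrightarrow> fps_X ^ M dvd f - g"

lemma fps_cong_refl [simp]: "fps_cong M f f"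
  by (simp add: fps_cong_def)

lemma fps_cong_sym: "fps_cong M f g \<Longrightarrow> fps_cong M g f"
  using dvd_minus_iff[of "fps_X ^ M" "f - g"] by (simp add: fps_cong_def)

lemma fps_cong_trans [trans]:
  assumes "fps_cong M f g" "fps_cong M g h"
  shows "fps_cong M f h"
  using dvd_add[of "fps_X ^ M" "f - g" "g - h"] assms by (simp add: fps_cong_def)

lemma fps_cong_add:
  assumes "fps_cong M f g" "fps_cong M f' g'"
  shows "fps_cong M (f + f') (g + g')"
  using dvd_add[of "fps_X ^ M" "f - g" "f' - g'"] assms by (simp add: fps_cong_def algebra_simps)

lemma fps_cong_mult:
  assumes "fps_cong M f g" "fps_cong M f' g'"
  shows "fps_cong M (f * f') (g * g')"
proof -
  have "f * f' - g * g' = f' * (f - g) + g * (f' - g')" by (simp add: algebra_simps)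
  thus ?thesis using assms by (simp add: fps_cong_def)
qed

lemma fps_cong_power: "fps_cong M f g \<Longrightarrow> fps_cong M (f ^ n) (g ^ n)"
  by (induction n) (auto intro: fps_cong_mult)

lemma fps_cong_prod:
  "(\<And>i. i \<in> A \<Longrightarrow> fps_cong M (f i) (g i)) \<Longrightarrow> fps_cong M (prod f A) (prod g A)"
  by (induction A rule: infinite_finite_induct) (auto intro: fps_cong_mult)

lemma fps_cong_sum:
  "(\<And>i. i \<in> A \<Longrightarrow> fps_cong M (f i) (g i)) \<Longrightarrow> fps_cong M (sum f A) (sum g A)"
  by (induction A rule: infinite_finite_induct) (auto intro: fps_cong_add)

lemma fps_cong_iff_nth: "fps_cong M f g \<longleftrightarrow> (\<forall>i<M. fps_nth f i = fps_nth g i)"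
proof
  assume "fps_cong M f g"
  then obtain h where "f = g + fps_X ^ M * h"
    by (auto simp: fps_cong_def dvd_def algebra_simps)
  thus "\<forall>i<M. fps_nth f i = fps_nth g i" by (simp add: fps_X_power_mult_nth)
next
  assume *: "\<forall>i<M. fps_nth f i = fps_nth g i"
  have "f - g = fps_X ^ M * fps_shift M (f - g)"
    by (rule fps_ext) (use * in \<open>simp add: fps_X_power_mult_nth\<close>)
  thus "fps_cong M f g" unfolding fps_cong_def by (metis dvd_triv_left)
qed

section \<open>Inverses of series with constant coefficient 1\<close>

abbreviation finv :: "'a::comm_ring_1 fps \<Rightarrow> 'a fps" where
  "finv f \<equiv> fps_right_inverse f 1"

lemma mult_finv: "fps_nth f 0 = 1 \<Longrightarrow> f * finv f = 1"
  by (rule fps_right_inverse) simp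

lemma finv_unique:
  assumes "f * g = 1" "fps_nth f 0 = 1"
  shows "g = finv f"
proof -
  have "g = f * g * finv f"
    using mult_finv[OF assms(2)] by (metis mult.commute mult.left_commute mult_1_right)
  thus ?thesis by (simp add: assms(1))
qed

lemma finv_mult:
  "fps_nth f 0 = 1 \<Longrightarrow> fps_nth g 0 = 1 \<Longrightarrow> finv (f * g) = finv f * finv g"
proof (rule finv_unique[symmetric])
  assume *: "fps_nth f 0 = 1" "fps_nth g 0 = 1"
  have "f * g * (finv f * finv g) = (f * finv f) * (g * finv g)" by (simp add: mult_ac)
  thus "f * g * (finv f * finv g) = 1" using * by (simp add: mult_finv)
qed simp

lemma finv_compose:
  fixes f g :: "'a::idom fps"
  assumes "fps_nth f 0 = 1" "fps_nth g 0 = 0"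
  shows "finv f oo g = finv (f oo g)"
proof (rule finv_unique)
  have "(f oo g) * (finv f oo g) = (f * finv f) oo g"
    using assms by (simp add: fps_compose_mult_distrib)
  thus "(f oo g) * (finv f oo g) = 1" using assms by (simp add: mult_finv)
qed (use assms in simp)

lemma fps_cong_cancel:
  assumes "fps_cong M (f * u) (g * u)" "fps_nth u 0 = 1"
  shows "fps_cong M f g"
proof -
  have "fps_cong M (f * u * finv u) (g * u * finv u)"
    using assms(1) by (rule fps_cong_mult) simp
  thus ?thesis using mult_finv[OF assms(2)] by (simp add: mult.assoc)
qed

subsection \<open>Product formulas\<close>

text \<open>
  The base parameter \<open>c = \<nu> z\<close> and the step \<open>r = z s\<close> cover both series that are needed:
  \<open>(z, s, \<nu>) = (-1, -q, -q)\<close> gives Gauss' theta product,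
  \<open>(z, s, \<nu>) = (q, q, 1)\<close> gives \<open>v0_term\<close>.
\<close>

definition psum :: "int fps \<Rightarrow> int fps \<Rightarrow> int fps \<Rightarrow> int fps \<Rightarrow> nat \<Rightarrow> int fps" where
  "psum c z r x M = (\<Sum>n\<le>M. \<Prod>i<n. c * r ^ i * (x + z * r ^ i) * finv (1 - x * c * r ^ i))"

lemma fps_X_power_dvd_power:
  assumes "fps_nth q 0 = 0"
  shows "fps_X ^ M dvd q ^ M"
proof -
  have "q = fps_X * fps_shift 1 q" by (rule fps_ext) (use assms in auto)
  thus ?thesis by (metis dvd_triv_left dvd_power_same)
qed

text \<open>This is the end point of iterating \<open>x\<close> to \<open>x * r\<close>: at
  \<open>x = 0\<close> the denominators disappear, and for both choices of parameters a partial
  theta series remains.\<close>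

lemma psum_cong_0:
  assumes x: "fps_X ^ M dvd x" and c: "fps_nth c 0 = 0"
  shows "fps_cong M (psum c z r x M) (\<Sum>n\<le>M. \<Prod>i<n. c * r ^ i * (z * r ^ i))"
proof -
  have "fps_cong M (finv (1 - x * c * r ^ i)) 1" for i
  proof (rule fps_cong_cancel)
    show u: "fps_nth (1 - x * c * r ^ i) 0 = 1" using c by simp
    have "fps_cong M 1 (1 - x * c * r ^ i)"
      using x by (simp add: fps_cong_def mult.assoc)
    thus "fps_cong M (finv (1 - x * c * r ^ i) * (1 - x * c * r ^ i)) (1 * (1 - x * c * r ^ i))"
      using mult_finv[OF u] by (simp add: mult.commute)
  qed
  moreover have "fps_cong M (x + z * r ^ i) (0 + z * r ^ i)" for i
    using x by (intro fps_cong_add) (auto simp: fps_cong_def)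
  ultimately have "fps_cong M (psum c z r x M) (\<Sum>n\<le>M. \<Prod>i<n. c * r ^ i * (0 + z * r ^ i) * 1)"
    unfolding psum_def by (intro fps_cong_sum fps_cong_prod fps_cong_mult fps_cong_refl)
  thus ?thesis by simp
qed

text \<open>The truncation error in \<open>telescoping_product_sum\<close> is a multiple of
  \<open>r ^ M\<close>, so it disappears modulo \<open>fps_X ^ M\<close>. Iterating the resulting
  functional equation moves \<open>x\<close> towards 0.\<close>

lemma psum_step:
  assumes c: "c = \<nu> * z" "fps_nth c 0 = 0" and r: "r = z * s" "fps_nth r 0 = 0"
  shows "fps_cong M ((1 + \<nu> * r * x\<^sup>2) * psum c z r (x * r) M)
           ((1 - c * x) * (1 + s * x) * psum c z r x M + \<nu> * r * x\<^sup>2 - s * x)"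
proof -
  define B where "B = (1 - c * x) * (1 + s * x)"
  define e where "e = (\<lambda>i. finv (1 - x * c * r ^ i))"
  have rM: "fps_X ^ M dvd r ^ M" by (rule fps_X_power_dvd_power[OF r(2)])
  have e: "(1 - x * c * r ^ i) * e i = 1" for i
    unfolding e_def by (rule mult_finv) (use c in simp)
  have e_Suc: "e (Suc i) = finv (1 - x * r * c * r ^ i)" for i
    by (simp add: e_def mult_ac)
  have e_fold: "finv (1 - x * c * r ^ i) = e i" for i
    by (simp add: e_def)
  obtain h where "(1 + \<nu> * r * x\<^sup>2) * psum c z r (x * r) M - B * psum c z r x M
      = \<nu> * r * x\<^sup>2 - s * x + r ^ M * h"
  proof
    show "(1 + \<nu> * r * x\<^sup>2) * psum c z r (x * r) M - B * psum c z r x M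
      = \<nu> * r * x\<^sup>2 - s * x
         + r ^ M * (B * x * c * e M * (\<Prod>i<M. c * r ^ i * (x + z * r ^ i) * e i))"
      using telescoping_product_sum[of r z s x \<nu> e M, folded c(1), OF r(1) e]
      unfolding psum_def B_def e_Suc[symmetric] e_fold
      by (simp only: mult_ac)
  qed
  hence "(1 + \<nu> * r * x\<^sup>2) * psum c z r (x * r) M - (B * psum c z r x M + \<nu> * r * x\<^sup>2 - s * x) = r ^ M * h"
    by (simp only: diff_diff_eq2 diff_diff_eq) (simp add: algebra_simps)
  thus ?thesis using rM unfolding fps_cong_def B_def by (metis dvd_mult2)
qed

lemma prod_lessThan_double:
  fixes f :: "nat \<Rightarrow> 'a::comm_monoid_mult"
  shows "(\<Prod>k<2 * M. f k) = (\<Prod>k<M. f (2 * k)) * (\<Prod>k<M. f (2 * k + 1))"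
  by (induction M) (simp_all add: mult_ac)

text \<open>The part of \<theta>(q) with |n| \<le> M. Doubling counts n = 0 twice, hence the
  subtracted 1.\<close>

definition theta_part :: "int fps \<Rightarrow> nat \<Rightarrow> int fps" where
  "theta_part q M = 2 * (\<Sum>n\<le>M. q ^ n\<^sup>2) - 1"

lemma power_Suc_square: "(q::'a::monoid_mult) ^ (Suc n)\<^sup>2 = q ^ n\<^sup>2 * q ^ (2 * n + 1)"
proof -
  have "(Suc n)\<^sup>2 = n\<^sup>2 + (2 * n + 1)" by (simp add: power2_eq_square)
  thus ?thesis by (simp only: power_add)
qed

lemma prod_odd_powers: "(\<Prod>i<n. q * (q\<^sup>2) ^ i) = (q::'a::comm_monoid_mult) ^ n\<^sup>2"
  by (induction n) (simp_all add: power_Suc_square power_mult[symmetric] mult_ac)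

text \<open>\<open>G N\<close> is taken at \<open>x = q ^ N\<close>. It starts at 1, each step
  contributes (1 - q^(N+1)) / (1 + q^(N+1)), and at N = M it agrees with \<theta>(-q) modulo
  \<open>fps_X ^ M\<close>.\<close>

lemma gauss_product_cong:
  assumes q: "fps_nth q 0 = 0"
  shows "fps_cong M (theta_part (-q) M * (\<Prod>k<M. 1 + q ^ Suc k)) (\<Prod>k<M. 1 - q ^ Suc k)"
proof -
  define G where "G N = 2 * psum q (-1) q (q ^ N) M - 1" for N
  have "fps_cong M (G N * (\<Prod>k<N. 1 + q ^ Suc k)) (\<Prod>k<N. 1 - q ^ Suc k)" for N
  proof (induction N)
    case 0
    \<comment> \<open>At \<open>x = 1\<close> the factor for i = 0 contains 1 - 1, so only the empty
      product survives.\<close>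
    have "(\<Prod>i<n. q * q ^ i * (1 + - 1 * q ^ i) * finv (1 - 1 * q * q ^ i)) = (if n = 0 then 1 else 0)" for n
      by (cases n) (auto simp: prod.lessThan_Suc_shift simp del: prod.lessThan_Suc)
    hence "psum q (-1) q 1 M = 1" unfolding psum_def by simp
    thus ?case by (simp add: G_def)
  next
    case (Suc N)
    define x P where "x = q ^ N" and "P = (\<Prod>k<N. 1 + q ^ Suc k)"
    have "fps_cong M ((1 + (-q) * q * x\<^sup>2) * psum q (-1) q (x * q) M)
           ((1 - q * x) * (1 + (-q) * x) * psum q (-1) q x M + (-q) * q * x\<^sup>2 - (-q) * x)"
      by (rule psum_step) (use q in auto)
    \<comment> \<open>Doubling and subtracting 1 - q^2 x^2 turns the inhomogeneous terms into -(1 -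
      q x)^2, so the equation becomes homogeneous in \<open>G\<close> and 1 - q x cancels.\<close>
    hence "fps_cong M (2 * ((1 + (-q) * q * x\<^sup>2) * psum q (-1) q (x * q) M) + -(1 + (-q) * q * x\<^sup>2))
       (2 * ((1 - q * x) * (1 + (-q) * x) * psum q (-1) q x M + (-q) * q * x\<^sup>2 - (-q) * x) + -(1 + (-q) * q * x\<^sup>2))"
      by (intro fps_cong_add fps_cong_mult) auto
    also have "2 * ((1 + (-q) * q * x\<^sup>2) * psum q (-1) q (x * q) M) + -(1 + (-q) * q * x\<^sup>2)
        = G (Suc N) * (1 + q ^ Suc N) * (1 - q * x)"
      by (simp add: G_def x_def algebra_simps power2_eq_square)
    also have "2 * ((1 - q * x) * (1 + (-q) * x) * psum q (-1) q x M + (-q) * q * x\<^sup>2 - (-q) * x) + -(1 + (-q) * q * x\<^sup>2)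
        = G N * (1 - q ^ Suc N) * (1 - q * x)"
      by (simp add: G_def x_def algebra_simps power2_eq_square)
    finally have "fps_cong M (G (Suc N) * (1 + q ^ Suc N)) (G N * (1 - q ^ Suc N))"
      by (rule fps_cong_cancel) (use q in simp)
    hence "fps_cong M (G (Suc N) * (1 + q ^ Suc N) * P) (G N * (1 - q ^ Suc N) * P)"
      by (rule fps_cong_mult[OF _ fps_cong_refl])
    also have "G N * (1 - q ^ Suc N) * P = G N * P * (1 - q ^ Suc N)" by (simp only: mult_ac)
    also have "fps_cong M \<dots> ((\<Prod>k<N. 1 - q ^ Suc k) * (1 - q ^ Suc N))"
      unfolding P_def by (intro fps_cong_mult Suc) auto
    finally show ?case by (simp add: P_def mult_ac del: power_Suc)
  qed
  note * = this[of M]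
  have "fps_cong M (G M) (theta_part (-q) M)"
  proof -
    have "fps_X ^ M dvd q ^ M" by (rule fps_X_power_dvd_power[OF q])
    hence "fps_cong M (psum q (-1) q (q ^ M) M) (\<Sum>n\<le>M. \<Prod>i<n. q * q ^ i * (-1 * q ^ i))"
      by (rule psum_cong_0) (rule q)
    also have "(\<Sum>n\<le>M. \<Prod>i<n. q * q ^ i * (-1 * q ^ i)) = (\<Sum>n\<le>M. (-q) ^ n\<^sup>2)"
      using prod_odd_powers[of "-q"] by (simp add: power2_eq_square power_mult_distrib mult_ac)
    finally have "fps_cong M (psum q (-1) q (q ^ M) M) (\<Sum>n\<le>M. (-q) ^ n\<^sup>2)" .
    hence "fps_cong M (2 * psum q (-1) q (q ^ M) M + - 1) (2 * (\<Sum>n\<le>M. (-q) ^ n\<^sup>2) + - 1)"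
      by (intro fps_cong_add fps_cong_mult) auto
    thus ?thesis by (simp add: G_def theta_part_def)
  qed
  hence "fps_cong M (theta_part (-q) M * (\<Prod>k<M. 1 + q ^ Suc k)) (G M * (\<Prod>k<M. 1 + q ^ Suc k))"
    by (intro fps_cong_mult fps_cong_sym[of M "G M"]) auto
  with * show ?thesis by (blast intro: fps_cong_trans)
qed

text \<open>
  The terms with \<open>x = -1\<close> are those of the bilateral extension of \<open>\<Sum> v0_term n\<close> at negative
  \<open>n\<close>; only for the bilateral series do the inhomogeneous terms of \<open>psum_step\<close> cancel.
\<close>

lemma v0_product_cong:
  fixes M :: nat
  defines "W \<equiv> psum fps_X fps_X (fps_X\<^sup>2) 1 M + psum fps_X fps_X (fps_X\<^sup>2) (-1) M - 1"
  shows "fps_cong M (W * (\<Prod>k<M. 1 - (fps_X\<^sup>2) ^ (2 * k + 1)))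
            (theta_part (fps_X\<^sup>2) M * (\<Prod>k<M. 1 + (fps_X\<^sup>2) ^ (2 * k + 1)))"
proof -
  define r :: "int fps" where "r = fps_X\<^sup>2"
  define V where "V = (\<lambda>\<epsilon> N. psum fps_X fps_X r (\<epsilon> * r ^ N) M)"
  define U where "U N = V 1 N + V (-1) N - 1" for N
  have r0: "fps_nth r 0 = 0" by (simp add: r_def)
  have step: "fps_cong M ((1 + r ^ (2 * N + 1)) * V \<epsilon> (Suc N))
           ((1 - r ^ (2 * N + 1)) * V \<epsilon> N + r ^ (2 * N + 1) - \<epsilon> * fps_X * r ^ N)"
    if \<epsilon>: "\<epsilon>\<^sup>2 = 1" for \<epsilon> N
  proof -
    define x where "x = \<epsilon> * r ^ N"
    have x2: "x\<^sup>2 = (r ^ N)\<^sup>2" using \<epsilon> by (simp add: x_def power_mult_distrib)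
    have rx: "1 * r * x\<^sup>2 = r ^ (2 * N + 1)"
      unfolding x2 by (simp add: power_mult[symmetric] mult.commute)
    have "fps_cong M ((1 + 1 * r * x\<^sup>2) * psum fps_X fps_X r (x * r) M)
         ((1 - fps_X * x) * (1 + fps_X * x) * psum fps_X fps_X r x M + 1 * r * x\<^sup>2 - fps_X * x)"
      by (rule psum_step) (auto simp: r_def power2_eq_square)
    also have x1: "(1 - fps_X * x) * (1 + fps_X * x) = 1 - 1 * r * x\<^sup>2"
      by (simp add: r_def algebra_simps power2_eq_square)
    finally show ?thesis unfolding rx by (simp add: V_def x_def mult_ac)
  qed
  have "fps_cong M (U 0 * (\<Prod>k<N. 1 - r ^ (2 * k + 1))) (U N * (\<Prod>k<N. 1 + r ^ (2 * k + 1)))" for N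
  proof (induction N)
    case (Suc N)
    define y P P' where "y = r ^ (2 * N + 1)" and "P = (\<Prod>k<N. 1 - r ^ (2 * k + 1))"
      and "P' = (\<Prod>k<N. 1 + r ^ (2 * k + 1))"
    \<comment> \<open>In the sum over both signs the terms linear in \<open>fps_X\<close> cancel,
      and subtracting 1 + y turns the remaining 2 y into -(1 - y), as required by
      \<open>U\<close>.\<close>
    have "fps_cong M ((1 + y) * V 1 (Suc N) + (1 + y) * V (-1) (Suc N) + (- 1 - y))
       (((1 - y) * V 1 N + y - 1 * fps_X * r ^ N) + ((1 - y) * V (-1) N + y - (-1) * fps_X * r ^ N) + (- 1 - y))"
      unfolding y_def by (intro fps_cong_add step fps_cong_refl) auto
    also have "(1 + y) * V 1 (Suc N) + (1 + y) * V (-1) (Suc N) + (- 1 - y) = U (Suc N) * (1 + y)"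
      by (simp add: U_def algebra_simps)
    also have "((1 - y) * V 1 N + y - 1 * fps_X * r ^ N) + ((1 - y) * V (-1) N + y - (-1) * fps_X * r ^ N) + (- 1 - y)
        = U N * (1 - y)"
      by (simp add: U_def algebra_simps)
    finally have *: "fps_cong M (U (Suc N) * (1 + y) * P') (U N * (1 - y) * P')"
      by (rule fps_cong_mult[OF _ fps_cong_refl])
    have "fps_cong M (U 0 * P * (1 - y)) (U N * P' * (1 - y))"
      using Suc unfolding P_def P'_def by (rule fps_cong_mult[OF _ fps_cong_refl])
    also have "U N * P' * (1 - y) = U N * (1 - y) * P'" by (simp only: mult_ac)
    also note fps_cong_sym[OF *]
    finally have "fps_cong M (U 0 * (P * (1 - y))) (U (Suc N) * (P' * (1 + y)))"
      by (simp only: mult_ac)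
    thus ?case by (simp add: P_def P'_def y_def)
  qed simp
  from this[of M]
  have "fps_cong M (U 0 * (\<Prod>k<M. 1 - r ^ (2 * k + 1))) (U M * (\<Prod>k<M. 1 + r ^ (2 * k + 1)))" .
  also have "fps_cong M \<dots> (theta_part r M * (\<Prod>k<M. 1 + r ^ (2 * k + 1)))"
  proof (rule fps_cong_mult[OF _ fps_cong_refl])
    have "fps_cong M (V \<epsilon> M) (\<Sum>n\<le>M. \<Prod>i<n. fps_X * r ^ i * (fps_X * r ^ i))" for \<epsilon>
      unfolding V_def by (rule psum_cong_0) (use fps_X_power_dvd_power[OF r0] in auto)
    moreover have "(\<Prod>i<n. fps_X * r ^ i * (fps_X * r ^ i)) = r ^ n\<^sup>2" for n
      using prod_odd_powers[of r n] by (simp add: r_def power2_eq_square power_mult_distrib mult_ac)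
    ultimately have V: "fps_cong M (V \<epsilon> M) (\<Sum>n\<le>M. r ^ n\<^sup>2)" for \<epsilon> by simp
    have "fps_cong M (V 1 M + V (-1) M + - 1) ((\<Sum>n\<le>M. r ^ n\<^sup>2) + (\<Sum>n\<le>M. r ^ n\<^sup>2) + - 1)"
      by (intro fps_cong_add V fps_cong_refl)
    thus "fps_cong M (U M) (theta_part r M)" by (simp add: U_def theta_part_def)
  qed
  finally show ?thesis by (simp add: U_def V_def W_def r_def)
qed

subsection \<open>The theta function\<close>

text \<open>Coefficients given as cardinalities over the integers let the square of
  \<open>theta\<close> count representations as sums of two squares.\<close>

definition theta :: "int fps" where
  "theta = Abs_fps (\<lambda>n. int (card {a::int. a\<^sup>2 = int n}))"

lemma theta_nth: "fps_nth theta n = (if n = 0 then 1 else if \<exists>k. n = k\<^sup>2 then 2 else 0)"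
proof (cases "\<exists>k. n = k\<^sup>2")
  case True
  then obtain k where k: "n = k\<^sup>2" by blast
  have "{a::int. a\<^sup>2 = int n} = {int k, - int k}"
    by (auto simp: k power2_eq_iff)
  thus ?thesis using True k by (auto simp: theta_def card_insert_if)
next
  case False
  have "{a::int. a\<^sup>2 = int n} = {}"
  proof safe
    fix a :: int assume "a\<^sup>2 = int n"
    hence "int ((nat \<bar>a\<bar>)\<^sup>2) = int n" by simp
    hence "n = (nat \<bar>a\<bar>)\<^sup>2" by linarith
    thus "a \<in> {}" using False by blast
  qed
  moreover have "n \<noteq> 0" using False by (metis power_zero_numeral)
  ultimately show ?thesis using False by (simp add: theta_def)
qed

lemma theta_nth_0 [simp]: "fps_nth theta 0 = 1"
  by (simp add: theta_nth)

lemma square_of_int_bounded: "(a::int)\<^sup>2 = int n \<Longrightarrow> a \<in> {-int n..int n}"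
proof -
  assume *: "a\<^sup>2 = int n"
  have "\<bar>a\<bar> \<le> \<bar>a\<bar>\<^sup>2"
    using power_increasing[of 1 2 "\<bar>a\<bar>"] by (cases "a = 0") auto
  thus ?thesis using * by auto
qed

lemma finite_square_eq [simp]: "finite {a::int. a\<^sup>2 = int n}"
  by (rule finite_subset[of _ "{-int n..int n}"]) (auto dest: square_of_int_bounded)

definition r2 :: "nat \<Rightarrow> nat" where
  "r2 n = card {(a::int, b::int). a\<^sup>2 + b\<^sup>2 = int n}"

lemma theta_square_nth: "fps_nth (theta\<^sup>2) n = int (r2 n)"
proof -
  have "{(a::int, b::int). a\<^sup>2 + b\<^sup>2 = int n} = (\<Union>i\<in>{0..n}. {a. a\<^sup>2 = int i} \<times> {b. b\<^sup>2 = int (n - i)})"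
  proof (intro subset_antisym subsetI)
    fix z assume "z \<in> {(a::int, b::int). a\<^sup>2 + b\<^sup>2 = int n}"
    then obtain a b :: int where z: "z = (a, b)" "a\<^sup>2 + b\<^sup>2 = int n" by auto
    have "nat (a\<^sup>2) \<le> n" "b\<^sup>2 = int (n - nat (a\<^sup>2))" "a\<^sup>2 = int (nat (a\<^sup>2))"
      using z(2) zero_le_power2[of a] zero_le_power2[of b] by linarith+
    thus "z \<in> (\<Union>i\<in>{0..n}. {a. a\<^sup>2 = int i} \<times> {b. b\<^sup>2 = int (n - i)})"
      unfolding z(1) by (intro UN_I[of "nat (a\<^sup>2)"]) auto
  qed (auto simp: of_nat_diff)
  also have "card \<dots> = (\<Sum>i=0..n. card ({a::int. a\<^sup>2 = int i} \<times> {b::int. b\<^sup>2 = int (n - i)}))"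
    by (rule card_UN_disjoint) (auto simp del: of_nat_diff)
  finally show ?thesis
    unfolding power2_eq_square[of theta] fps_mult_nth
    by (simp add: r2_def theta_def card_cartesian_product)
qed

text \<open>The map (a, b) to (a + b, a - b) doubles a^2 + b^2. It is onto because an even sum of
  two squares forces a and b to have the same parity.\<close>

lemma r2_double: "r2 (2 * n) = r2 n"
  unfolding r2_def
proof (rule bij_betw_same_card[symmetric])
  show "bij_betw (\<lambda>(a, b). (a + b, a - b)) {(a::int, b::int). a\<^sup>2 + b\<^sup>2 = int n}
          {(a, b). a\<^sup>2 + b\<^sup>2 = int (2 * n)}"
  proof (rule bij_betw_byWitness[where f' = "\<lambda>(a, b). ((a + b) div 2, (a - b) div 2)"])
    show "(\<lambda>(a, b). ((a + b) div 2, (a - b) div 2)) ` {(a, b). a\<^sup>2 + b\<^sup>2 = int (2 * n)}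
            \<subseteq> {(a::int, b::int). a\<^sup>2 + b\<^sup>2 = int n}"
    proof safe
      fix a b :: int assume ab: "a\<^sup>2 + b\<^sup>2 = int (2 * n)"
      hence "even (a\<^sup>2 + b\<^sup>2)" by simp
      hence "even (a + b)" by simp
      then obtain u where u: "a + b = 2 * u" by (elim evenE)
      have b: "b = 2 * u - a" and u': "(a - b) div 2 = a - u" using u by auto
      show "((a + b) div 2)\<^sup>2 + ((a - b) div 2)\<^sup>2 = int n"
        using ab unfolding u u' by (simp add: b power2_eq_square algebra_simps)
    qed
    show "\<forall>z\<in>{(a::int, b::int). a\<^sup>2 + b\<^sup>2 = int (2 * n)}.
        (\<lambda>(a, b). (a + b, a - b)) ((\<lambda>(a, b). ((a + b) div 2, (a - b) div 2)) z) = z"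
    proof
      fix z :: "int \<times> int" assume "z \<in> {(a, b). a\<^sup>2 + b\<^sup>2 = int (2 * n)}"
      then obtain a b where z: "z = (a, b)" "a\<^sup>2 + b\<^sup>2 = int (2 * n)" by auto
      hence "even (a\<^sup>2 + b\<^sup>2)" by simp
      hence "even (a + b)" by simp
      then obtain u where u: "a + b = 2 * u" by (elim evenE)
      have "(a + b) div 2 = u" "(a - b) div 2 = a - u" using u by auto
      thus "(\<lambda>(a, b). (a + b, a - b)) ((\<lambda>(a, b). ((a + b) div 2, (a - b) div 2)) z) = z"
        using u by (simp add: z)
    qed
  qed (auto simp: power2_eq_square algebra_simps)
qed

lemma fps_nth_compose_X_power:
  "fps_nth ((f :: 'a::comm_ring_1 fps) oo fps_X ^ k) n = (if k dvd n then fps_nth f (n div k) else 0)"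
  if "k > 0"
proof -
  have "fps_nth (f oo fps_X ^ k) n = (\<Sum>i=0..n. if i * k = n then fps_nth f i else 0)"
    by (auto simp: fps_compose_nth power_mult[symmetric] mult.commute intro!: sum.cong)
  also have "\<dots> = (\<Sum>i\<in>{i. i * k = n}. fps_nth f i)"
  proof -
    have "i \<le> i * k" for i using that by simp
    hence "{0..n} \<inter> {i. i * k = n} = {i. i * k = n}" by auto
    thus ?thesis by (simp add: sum.If_cases)
  qed
  also have "{i. i * k = n} = (if k dvd n then {n div k} else {})"
    using that by auto
  finally show ?thesis by simp
qed

lemma fps_nth_compose_uminus_X:
  "fps_nth ((f :: 'a::comm_ring_1 fps) oo (- fps_X)) n = (- 1) ^ n * fps_nth f n"
  by (simp add: fps_compose_uminus')

text \<open>Odd coefficients cancel on the left; at even exponents this is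
  \<open>r2_double\<close>.\<close>

lemma theta_square_add: "theta\<^sup>2 + (theta oo (- fps_X))\<^sup>2 = 2 * (theta oo fps_X\<^sup>2)\<^sup>2"
proof (rule fps_ext)
  fix n
  have 1: "(theta oo (- fps_X))\<^sup>2 = theta\<^sup>2 oo (- fps_X)" "(theta oo fps_X\<^sup>2)\<^sup>2 = theta\<^sup>2 oo fps_X\<^sup>2"
    by (simp_all add: fps_compose_power)
  show "fps_nth (theta\<^sup>2 + (theta oo (- fps_X))\<^sup>2) n = fps_nth (2 * (theta oo fps_X\<^sup>2)\<^sup>2) n"
    unfolding 1 by (auto simp: fps_nth_compose_uminus_X fps_nth_compose_X_power theta_square_nth
        numeral_fps_const r2_double elim!: evenE)
qed

text \<open>The even squares are exactly 4 times the squares.\<close>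

lemma theta_compose_uminus_add: "theta + (theta oo (- fps_X)) = 2 * (theta oo fps_X ^ 4)"
proof (rule fps_ext)
  fix n
  have "fps_nth theta n = fps_nth theta (n div 4)" if *: "4 dvd n"
  proof -
    obtain m where n: "n = 4 * m" using * by (elim dvdE)
    have "(\<exists>k. 4 * m = k\<^sup>2) \<longleftrightarrow> (\<exists>k. m = k\<^sup>2)"
    proof safe
      fix k assume k: "4 * m = k\<^sup>2"
      hence "even (k\<^sup>2)" by (metis dvd_mult2 even_numeral)
      then obtain j where "k = 2 * j" by auto
      thus "\<exists>k. m = k\<^sup>2" using k by (auto simp: power2_eq_square)
    next
      fix k :: nat show "\<exists>j. 4 * k\<^sup>2 = j\<^sup>2" by (rule exI[of _ "2 * k"]) (simp add: power2_eq_square)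
    qed
    thus ?thesis by (simp add: n theta_nth)
  qed
  moreover have "fps_nth theta n = 0" if "\<not> 4 dvd n" "even n"
  proof -
    have "n \<noteq> k\<^sup>2" for k
    proof
      assume "n = k\<^sup>2"
      with that have "even k" by simp
      thus False using that \<open>n = k\<^sup>2\<close> by (auto simp: power2_eq_square elim!: evenE)
    qed
    moreover have "n \<noteq> 0" using that(1) by (cases n) auto
    ultimately show ?thesis by (auto simp: theta_nth)
  qed
  moreover have "even n" if "4 dvd n" using that by (meson dvd_trans even_numeral)
  ultimately have "fps_nth theta n + (- 1) ^ n * fps_nth theta n = (if 4 dvd n then 2 * fps_nth theta (n div 4) else 0)"
    by (cases "even n"; cases "4 dvd n") simp_all
  thus "fps_nth (theta + (theta oo (- fps_X))) n = fps_nth (2 * (theta oo fps_X ^ 4)) n"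
    by (simp add: fps_nth_compose_uminus_X fps_nth_compose_X_power numeral_fps_const)
qed

subsection \<open>Dissecting the generating function\<close>

text \<open>Each coefficient of the partial sums is eventually constant, so the topological limit
  can be replaced by a finite sum.\<close>

lemma v0_eq_sum:
  assumes "m \<le> M"
  shows "v0 m = fps_nth (\<Sum>k\<le>M. v0_term k) m"
proof -
  have "(\<lambda>N. \<Sum>k<N. v0_term k) \<longlonglongrightarrow> (\<Sum>k. v0_term k)"
    using summable_LIMSEQ[OF summable_v0_term] .
  hence "eventually (\<lambda>N. fps_nth (\<Sum>k<N. v0_term k) m = v0 m) sequentially"
    unfolding tendsto_fps_iff v0_def by blast
  then obtain N where N: "N > M" "fps_nth (\<Sum>k<N. v0_term k) m = v0 m"
    using eventually_conj[OF _ eventually_gt_at_top[of M]] eventually_happens'[OF sequentially_bot]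
    by (metis (mono_tags, lifting))
  have "(\<Sum>k<N. fps_nth (v0_term k) m) = (\<Sum>k\<le>M. fps_nth (v0_term k) m)"
    by (rule sum.mono_neutral_right) (use N assms fps_nth_v0_term_eq_0 in auto)
  thus ?thesis using N by (simp add: fps_sum_nth)
qed

lemma q_poch_eq: "q_poch a q n = (\<Prod>i<n. 1 - a * q ^ i)"
  by (induction n) (simp_all add: q_poch_def)

lemma fps_prod_nth_0: "fps_nth (\<Prod>i\<in>A. f i) 0 = (\<Prod>i\<in>A. fps_nth (f i) 0)"
  by (induction A rule: infinite_finite_induct) simp_all

lemma finv_prod:
  fixes n :: nat
  shows "(\<And>i. i < n \<Longrightarrow> fps_nth (f i) 0 = 1) \<Longrightarrow> finv (\<Prod>i<n. f i) = (\<Prod>i<n. finv (f i))"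
proof (induction n)
  case 0
  show ?case using finv_unique[of 1 1] by simp
next
  case (Suc n)
  have "fps_nth (\<Prod>i<n. f i) 0 = 1" using Suc.prems
    by (simp add: fps_prod_nth_0)
  thus ?case using Suc by (simp add: finv_mult)
qed

lemma v0_term_eq: "v0_term n = (\<Prod>i<n. fps_X * (fps_X\<^sup>2) ^ i * (1 + fps_X * (fps_X\<^sup>2) ^ i)
    * finv (1 - 1 * fps_X * (fps_X\<^sup>2) ^ i))"
proof -
  have "finv (\<Prod>i<n. 1 - fps_X * (fps_X\<^sup>2) ^ i) = (\<Prod>i<n. finv (1 - 1 * fps_X * (fps_X\<^sup>2) ^ i) :: int fps)"
    by (subst finv_prod) auto
  moreover have "fps_X ^ n\<^sup>2 = (\<Prod>i<n. fps_X * (fps_X\<^sup>2) ^ i :: int fps)"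
    by (rule prod_odd_powers[symmetric])
  moreover have "q_poch (- fps_X) (fps_X\<^sup>2) n = (\<Prod>i<n. 1 + fps_X * (fps_X\<^sup>2) ^ i :: int fps)"
    by (simp add: q_poch_eq)
  ultimately show ?thesis
    unfolding v0_term_def q_poch_eq by (simp only: prod.distrib[symmetric])
qed

lemma psum_1: "psum fps_X fps_X (fps_X\<^sup>2) 1 M = (\<Sum>n\<le>M. v0_term n)"
  by (simp add: psum_def v0_term_eq)

text \<open>Substituting \<open>- fps_X\<close> negates \<open>c\<close> and \<open>z\<close> but
  fixes \<open>r\<close>; moving both signs onto \<open>x\<close> turns \<open>x = 1\<close> into
  \<open>x = -1\<close>.\<close>

lemma psum_minus_1: "psum fps_X fps_X (fps_X\<^sup>2) (-1) M = (\<Sum>n\<le>M. v0_term n) oo (- fps_X)"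
proof -
  have "fps_X * (fps_X\<^sup>2) ^ i * (-1 + fps_X * (fps_X\<^sup>2) ^ i) * finv (1 - (-1) * fps_X * (fps_X\<^sup>2) ^ i)
     = (fps_X * (fps_X\<^sup>2) ^ i * (1 + fps_X * (fps_X\<^sup>2) ^ i) * finv (1 - 1 * fps_X * (fps_X\<^sup>2) ^ i))
        oo (- fps_X :: int fps)" for i
  proof -
    have X: "fps_X * (fps_X\<^sup>2) ^ i oo (- fps_X) = - (fps_X * (fps_X\<^sup>2) ^ i :: int fps)"
      by (simp add: fps_compose_mult_distrib fps_compose_power[symmetric] power2_eq_square)
    have "finv (1 - 1 * fps_X * (fps_X\<^sup>2) ^ i) oo (- fps_X) = finv (1 - (-1) * fps_X * (fps_X\<^sup>2) ^ i :: int fps)"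
      by (subst finv_compose) (simp_all add: fps_compose_sub_distrib X)
    thus ?thesis
      by (simp add: fps_compose_mult_distrib[where c = "- fps_X"] fps_compose_add_distrib X[simplified fps_compose_mult_distrib])
         (simp add: fps_compose_power[symmetric] algebra_simps)
  qed
  thus ?thesis
    by (simp add: psum_def v0_term_eq fps_compose_sum_distrib fps_compose_prod_distrib)
qed

text \<open>The bilateral series of the introduction in the variable q^2: the series and its image
  under q to -q share the term n = 0, hence the subtracted 1.\<close>

definition v0_even :: "int fps" where
  "v0_even = Abs_fps (\<lambda>n. 2 * v0 (2 * n) - (if n = 0 then 1 else 0))"

lemma psum_cong_v0_even:
  "fps_cong M (psum fps_X fps_X (fps_X\<^sup>2) 1 M + psum fps_X fps_X (fps_X\<^sup>2) (-1) M - 1) (v0_even oo fps_X\<^sup>2)"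
  unfolding fps_cong_iff_nth psum_1 psum_minus_1
  by (auto simp: fps_nth_compose_uminus_X fps_nth_compose_X_power v0_even_def v0_eq_sum[of _ M]
      simp del: One_nat_def elim!: evenE)

section \<open>From truncated congruences to identities of power series\<close>

lemma fps_cong_compose:
  fixes q :: "'a::idom fps"
  assumes "fps_cong M f g" and q: "fps_nth q 0 = 0"
  shows "fps_cong M (f oo q) (g oo q)"
proof -
  obtain h where h: "f - g = fps_X ^ M * h" using assms(1) by (auto simp: fps_cong_def)
  have "(f oo q) - (g oo q) = (f - g) oo q" by (simp add: fps_compose_sub_distrib)
  also have "\<dots> = q ^ M * (h oo q)"
    using q by (simp add: h fps_compose_mult_distrib fps_X_power_compose)
  finally show ?thesis using fps_X_power_dvd_power[OF q, of M] by (simp add: fps_cong_def)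
qed

lemma theta_part_cong:
  assumes q: "fps_nth q 0 = 0"
  shows "fps_cong M (theta_part q M) (theta oo q)"
proof -
  have "theta_part q M = theta_part fps_X M oo q"
    using q by (simp add: theta_part_def fps_compose_sub_distrib fps_compose_mult_distrib
        fps_compose_sum_distrib fps_X_power_compose)
  also have "fps_cong M \<dots> (theta oo q)"
  proof (rule fps_cong_compose[OF _ q])
    have "fps_nth (theta_part fps_X M) m = fps_nth theta m" if "m < M" for m
    proof -
      have "fps_nth (theta_part fps_X M) m = 2 * (\<Sum>n\<le>M. if n\<^sup>2 = m then 1 else 0) - (if m = 0 then 1 else 0)"
        by (auto simp: theta_part_def numeral_fps_const fps_sum_nth intro!: sum.cong)
      also have "(\<Sum>n\<le>M. if n\<^sup>2 = m then 1 else 0 :: int) = (if \<exists>k. m = k\<^sup>2 then 1 else 0)"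
      proof (cases "\<exists>k. m = k\<^sup>2")
        case True
        then obtain k where k: "m = k\<^sup>2" by blast
        have "k \<le> k\<^sup>2" by (simp add: power2_eq_square)
        hence "(\<Sum>n\<le>M. if n\<^sup>2 = m then 1 else 0 :: int) = (\<Sum>n\<le>M. if n = k then 1 else 0)"
          by (intro sum.cong) (auto simp: k)
        also have "\<dots> = 1" using \<open>k \<le> k\<^sup>2\<close> that k by simp
        finally show ?thesis using True by simp
      qed (auto intro!: sum.neutral)
      also have "2 * (if \<exists>k. m = k\<^sup>2 then 1 else 0) - (if m = 0 then 1 else 0) = fps_nth theta m"
        by (auto simp: theta_nth)
      finally show ?thesis .
    qed
    thus "fps_cong M (theta_part fps_X M) theta" by (simp add: fps_cong_iff_nth)
  qed
  finally show ?thesis .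
qed

lemma fps_eqI_cong: "(\<And>M. fps_cong M f g) \<Longrightarrow> f = g"
  unfolding fps_cong_iff_nth by (rule fps_ext) blast

definition theta_neg :: "int fps" where "theta_neg = theta oo (- fps_X)"

lemma theta_neg_nth_0 [simp]: "fps_nth theta_neg 0 = 1"
  by (simp add: theta_neg_def)

lemma fps_cong_mono: "fps_cong N f g \<Longrightarrow> M \<le> N \<Longrightarrow> fps_cong M f g"
  by (simp add: fps_cong_iff_nth)

lemma prod_pos_neg_split:
  fixes q :: "'a::comm_ring_1"
  shows "(\<Prod>k<2*M. 1 + q ^ Suc k) = (\<Prod>k<M. 1 + q ^ (2 * k + 1)) * (\<Prod>k<M. 1 + q ^ (2 * k + 2))"
    and "(\<Prod>k<2*M. 1 - q ^ Suc k) = (\<Prod>k<M. 1 - q ^ (2 * k + 1)) * (\<Prod>k<M. 1 - q ^ (2 * k + 2))"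
  by (simp_all add: prod_lessThan_double)

text \<open>Let Op and Om be the products of 1 + q^k and 1 - q^k over odd k. The bilateral product
  says \<open>v0_even\<close> = \<theta>(q) Op / Om, while Gauss' product at q and at -q gives (Op /
  Om)^2 = \<theta>(q) / \<theta>(-q).\<close>

lemma v0_even_square: "v0_even\<^sup>2 * theta_neg = theta ^ 3"
proof -
  define q :: "int fps" where "q = fps_X\<^sup>2"
  have q0: "fps_nth q 0 = 0" "fps_nth (-q) 0 = 0" by (simp_all add: q_def)
  have "fps_cong M ((v0_even oo q)\<^sup>2 * (theta oo (-q))) ((theta oo q) ^ 3)" for M
  proof -
    define Op Om Ep Em where O_E: "Op = (\<Prod>k<M. 1 + q ^ (2 * k + 1))" "Om = (\<Prod>k<M. 1 - q ^ (2 * k + 1))"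
      "Ep = (\<Prod>k<M. 1 + q ^ (2 * k + 2))" "Em = (\<Prod>k<M. 1 - q ^ (2 * k + 2))"
    have nz: "fps_nth Op 0 = 1" "fps_nth Om 0 = 1" "fps_nth Ep 0 = 1"
      using q0 by (simp_all add: O_E fps_prod_nth_0)
    define W a b where "W = v0_even oo q" and "a = theta oo q" and "b = theta oo (-q)"
    have W: "fps_cong M (W * Om) (a * Op)"
    proof -
      note fps_cong_sym[OF fps_cong_mult[OF psum_cong_v0_even fps_cong_refl]]
      also note v0_product_cong
      also have "fps_cong M (theta_part (fps_X\<^sup>2) M * (\<Prod>k<M. 1 + (fps_X\<^sup>2) ^ (2 * k + 1))) (a * Op)"
        unfolding a_def O_E q_def by (intro fps_cong_mult[OF theta_part_cong]) auto
      finally show ?thesis by (simp only: W_def O_E q_def)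
    qed
    \<comment> \<open>Gauss' product is used at level 2M, so that its factors split into M odd and M
      even ones.\<close>
    have g: "fps_cong M ((theta oo (-p)) * (\<Prod>k<2*M. 1 + p ^ Suc k)) (\<Prod>k<2*M. 1 - p ^ Suc k)"
      if p: "fps_nth p 0 = 0" for p
    proof -
      have "fps_cong (2 * M) ((theta oo (-p)) * (\<Prod>k<2*M. 1 + p ^ Suc k)) (\<Prod>k<2*M. 1 - p ^ Suc k)"
        by (rule fps_cong_trans[OF _ gauss_product_cong[OF p]])
           (intro fps_cong_mult[OF fps_cong_sym[OF theta_part_cong]], use p in auto)
      thus ?thesis by (rule fps_cong_mono) simp
    qed
    have b: "fps_cong M (b * (Op * Ep)) (Om * Em)"
      using g[OF q0(1)] unfolding prod_pos_neg_split b_def O_E .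
    \<comment> \<open>Replacing q by -q swaps \<open>Op\<close> and \<open>Om\<close> and fixes the
      even factors.\<close>
    have a: "fps_cong M (a * (Om * Ep)) (Op * Em)"
      using g[OF q0(2)] unfolding prod_pos_neg_split a_def O_E
      by (simp add: power_minus_even power_minus_odd)
    have "fps_cong M (a * (Om * Ep) * Om) (Op * Em * Om)"
      by (rule fps_cong_mult[OF a fps_cong_refl])
    moreover have "fps_cong M (Om * Em * Op) (b * (Op * Ep) * Op)"
      by (rule fps_cong_sym[OF fps_cong_mult[OF b fps_cong_refl]])
    ultimately have "fps_cong M (a * Om\<^sup>2 * Ep) (b * Op\<^sup>2 * Ep)"
      using fps_cong_trans by (fastforce simp: power2_eq_square mult_ac)
    hence ab: "fps_cong M (a * Om\<^sup>2) (b * Op\<^sup>2)"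
      by (rule fps_cong_cancel) (use nz in simp)
    have "fps_cong M ((W * Om)\<^sup>2 * (b * Op\<^sup>2)) ((a * Op)\<^sup>2 * (a * Om\<^sup>2))"
      by (intro fps_cong_mult fps_cong_power W fps_cong_sym[OF ab])
    hence "fps_cong M (W\<^sup>2 * b * (Om\<^sup>2 * Op\<^sup>2)) (a ^ 3 * (Om\<^sup>2 * Op\<^sup>2))"
      by (simp add: power_mult_distrib power3_eq_cube power2_eq_square mult_ac)
    hence "fps_cong M (W\<^sup>2 * b) (a ^ 3)"
      by (rule fps_cong_cancel) (use nz in \<open>simp add: fps_nth_power_0\<close>)
    thus ?thesis unfolding W_def a_def b_def .
  qed
  hence eq: "(v0_even oo q)\<^sup>2 * (theta oo (-q)) = (theta oo q) ^ 3" by (rule fps_eqI_cong)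
  have "theta oo (-q) = theta_neg oo q"
    unfolding theta_neg_def using q0 by (subst fps_compose_assoc[symmetric]) (simp_all add: fps_compose_uminus)
  hence "(v0_even\<^sup>2 * theta_neg - theta ^ 3) oo q = 0"
    using eq q0 by (simp add: fps_compose_sub_distrib fps_compose_mult_distrib fps_compose_power)
  moreover have "q \<noteq> 0" by (simp add: q_def)
  ultimately show ?thesis using q0 by (simp add: fps_compose_eq_0_iff)
qed

section \<open>The series of \<open>v0\<close> at multiples of 4\<close>

definition v0_quad :: "int fps" where
  "v0_quad = Abs_fps (\<lambda>n. 2 * v0 (4 * n) - (if n = 0 then 1 else 0))"

lemma v0_0: "v0 0 = 1"
  by (simp add: v0_eq_sum[of 0 0] v0_term_def q_poch_def)

lemma fps_square_eqD:
  fixes f h :: "int fps"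
  assumes "f\<^sup>2 = h\<^sup>2" "fps_nth f 0 = 1" "fps_nth h 0 = 1"
  shows "f = h"
proof -
  have "f \<noteq> - h" using assms by (metis fps_neg_nth one_neq_neg_one)
  thus ?thesis using assms(1) by (simp add: power2_eq_iff)
qed

lemma fps_compose_X_power_inject:
  fixes f h :: "'a::idom fps"
  assumes "f oo fps_X ^ k = h oo fps_X ^ k" "k > 0"
  shows "f = h"
proof -
  have "(f - h) oo fps_X ^ k = 0" using assms by (simp add: fps_compose_sub_distrib)
  thus ?thesis using assms(2) by (subst (asm) fps_compose_eq_0_iff) auto
qed

lemma compose_uminus_X_twice: "(f oo (- fps_X)) oo (- fps_X) = (f :: int fps)"
  by (rule fps_ext) (simp add: fps_nth_compose_uminus_X mult.assoc[symmetric] power_mult_distrib[symmetric])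

lemma compose_X_squared_twice: "(f oo fps_X\<^sup>2) oo fps_X\<^sup>2 = (f oo fps_X ^ 4 :: int fps)"
  by (subst fps_compose_assoc[symmetric]) (simp_all add: fps_X_power_compose power_mult[symmetric])

text \<open>2 x y = (x + y)^2 - (x^2 + y^2) expresses the product through \<theta>(q^4) and
  \<theta>(q^2); \<open>theta_square_add\<close> at q^2 identifies the result.\<close>

lemma theta_mult_theta_neg: "theta * theta_neg = (theta_neg oo fps_X\<^sup>2)\<^sup>2"
proof -
  define a where "a = theta oo fps_X\<^sup>2"
  define b where "b = theta oo fps_X ^ 4"
  have 1: "theta\<^sup>2 + theta_neg\<^sup>2 = 2 * a\<^sup>2" "theta + theta_neg = 2 * b"
    using theta_square_add theta_compose_uminus_add by (simp_all add: a_def b_def theta_neg_def)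
  have "(theta\<^sup>2 + theta_neg\<^sup>2) oo fps_X\<^sup>2 = (2 * a\<^sup>2) oo fps_X\<^sup>2" using 1 by simp
  hence 2: "a\<^sup>2 + (theta_neg oo fps_X\<^sup>2)\<^sup>2 = 2 * b\<^sup>2"
    by (simp add: fps_compose_add_distrib fps_compose_mult_distrib fps_compose_power[symmetric]
        a_def b_def compose_X_squared_twice)
  have "2 * (theta * theta_neg) = (theta + theta_neg)\<^sup>2 - (theta\<^sup>2 + theta_neg\<^sup>2)"
    by (simp add: power2_eq_square algebra_simps)
  also have "\<dots> = 2 * (2 * b\<^sup>2 - a\<^sup>2)" unfolding 1 by (simp add: power2_eq_square)
  also have "2 * b\<^sup>2 - a\<^sup>2 = (theta_neg oo fps_X\<^sup>2)\<^sup>2" using 2 by (simp add: algebra_simps)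
  finally show ?thesis by simp
qed

text \<open>With K = \<open>v0_even\<close> and Km its image under q to -q, K + Km is twice
  \<open>v0_quad\<close> at q^2. The squares of K and Km are known, and K Km = \<theta>(q)
  \<theta>(-q), the sign being fixed by the constant coefficient. Squaring the sum gives a perfect
  square, whose root is taken in the same way.\<close>

lemma v0_quad_mult_theta_neg: "v0_quad * theta_neg = theta\<^sup>2"
proof -
  define Km where "Km = v0_even oo (- fps_X)"
  have theta_neg_uminus: "theta_neg oo (- fps_X) = theta"
    by (simp add: theta_neg_def compose_uminus_X_twice)
  have "(v0_even\<^sup>2 * theta_neg) oo (- fps_X) = (theta ^ 3) oo (- fps_X)" by (simp add: v0_even_square)
  hence Km: "Km\<^sup>2 * theta = theta_neg ^ 3"
    by (simp add: fps_compose_mult_distrib fps_compose_power[symmetric] theta_neg_uminus Km_def theta_neg_def[symmetric])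
  have nz: "theta \<noteq> 0" "theta_neg \<noteq> 0" using theta_nth_0 theta_neg_nth_0 by (metis fps_zero_nth zero_neq_one)+
  have K0: "fps_nth v0_even 0 = 1" by (simp add: v0_even_def v0_0)
  have "(v0_even * Km)\<^sup>2 * (theta * theta_neg) = (v0_even\<^sup>2 * theta_neg) * (Km\<^sup>2 * theta)" by (simp add: power_mult_distrib mult_ac)
  also have "\<dots> = (theta * theta_neg)\<^sup>2 * (theta * theta_neg)"
    unfolding v0_even_square Km by (simp add: power2_eq_square power3_eq_cube mult_ac)
  finally have "(v0_even * Km)\<^sup>2 = (theta * theta_neg)\<^sup>2" using nz by simp
  hence KKm: "v0_even * Km = theta * theta_neg"
    by (rule fps_square_eqD) (simp_all add: K0 Km_def)
  have "v0_even + Km = 2 * (v0_quad oo fps_X\<^sup>2)"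
    by (rule fps_ext) (auto simp: Km_def fps_nth_compose_uminus_X fps_nth_compose_X_power
        numeral_fps_const v0_even_def v0_quad_def elim!: evenE)
  hence "4 * ((v0_quad oo fps_X\<^sup>2)\<^sup>2 * (theta * theta_neg)) = (v0_even + Km)\<^sup>2 * (theta * theta_neg)"
    by (simp add: power2_eq_square)
  also have "\<dots> = (v0_even\<^sup>2 * theta_neg) * theta + (Km\<^sup>2 * theta) * theta_neg + 2 * (v0_even * Km) * (theta * theta_neg)"
    by (simp add: power2_eq_square algebra_simps)
  also have "\<dots> = (theta\<^sup>2 + theta_neg\<^sup>2)\<^sup>2"
    unfolding v0_even_square Km KKm by (simp add: power2_eq_square power3_eq_cube algebra_simps)
  also have "\<dots> = 4 * ((theta oo fps_X\<^sup>2)\<^sup>2)\<^sup>2"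
    using theta_square_add unfolding theta_neg_def[symmetric] by (simp add: power_mult_distrib)
  finally have "((v0_quad oo fps_X\<^sup>2) * (theta_neg oo fps_X\<^sup>2))\<^sup>2 = ((theta oo fps_X\<^sup>2)\<^sup>2)\<^sup>2"
    unfolding theta_mult_theta_neg by (simp add: power_mult_distrib)
  hence "(v0_quad oo fps_X\<^sup>2) * (theta_neg oo fps_X\<^sup>2) = (theta oo fps_X\<^sup>2)\<^sup>2"
    by (rule fps_square_eqD) (simp_all add: v0_quad_def v0_0 fps_nth_power_0)
  hence "(v0_quad * theta_neg) oo fps_X\<^sup>2 = theta\<^sup>2 oo fps_X\<^sup>2"
    by (simp add: fps_compose_mult_distrib fps_compose_power)
  thus ?thesis by (rule fps_compose_X_power_inject) simp
qed

subsection \<open>The 4-dissection of theta\<close>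

text \<open>Ramanujan's \<psi>(q), the sum of q^(k(k+1)/2) over k \<ge> 0, since 8 n + 1 is a square
  exactly for triangular n.\<close>

definition psi :: "int fps" where
  "psi = Abs_fps (\<lambda>n. fps_nth theta (8 * n + 1) div 2)"

lemma square_mod_8: "(k::nat)\<^sup>2 mod 8 \<in> {0, 1, 4}"
proof -
  have "k mod 8 \<in> {0..<8}" by simp
  hence "(k mod 8)\<^sup>2 mod 8 \<in> {0, 1, 4}"
    by (auto simp: atLeastLessThan_nat_numeral power2_eq_square)
  thus ?thesis by (simp add: power_mod)
qed

text \<open>\<theta>(q) = \<theta>(q^4) + 2 q \<psi>(q^8): even squares give the first part, and odd
  squares are 1 modulo 8.\<close>

lemma theta_dissection: "theta = (theta oo fps_X ^ 4) + fps_X * (2 * (psi oo fps_X\<^sup>2) oo fps_X ^ 4)"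
proof (rule fps_ext)
  fix n :: nat
  have sq: "fps_nth theta n = 0" if "n mod 8 \<notin> {0, 1, 4}" for n
  proof -
    have "\<not> (\<exists>k. n = k\<^sup>2)" using that square_mod_8 by blast
    moreover have "n \<noteq> 0" using that by (cases n) auto
    ultimately show ?thesis by (simp add: theta_nth)
  qed
  have "4 dvd n \<or> n mod 4 = 1 \<or> n mod 4 = 2 \<or> n mod 4 = 3" by presburger
  then consider "4 dvd n" | "n mod 4 = 1" | "n mod 4 = 2 \<or> n mod 4 = 3" by blast
  thus "fps_nth theta n = fps_nth ((theta oo fps_X ^ 4) + fps_X * (2 * (psi oo fps_X\<^sup>2) oo fps_X ^ 4)) n"
  proof cases
    case 1
    have "\<not> 4 dvd n - 1 \<or> n = 0" using 1 by presburger
    moreover have "fps_nth theta n = fps_nth (theta oo fps_X ^ 4) n"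
    proof -
      have "2 * fps_nth theta n = fps_nth (theta + (theta oo (- fps_X))) n"
        using 1 by (auto simp: fps_nth_compose_uminus_X elim!: dvdE)
      thus ?thesis unfolding theta_compose_uminus_add by (simp add: numeral_fps_const)
    qed
    ultimately show ?thesis by (auto simp: fps_nth_compose_X_power)
  next
    case 2
    hence n: "n > 0" "4 dvd n - 1" "\<not> 4 dvd n" by presburger+
    have "fps_nth theta n = (if even ((n - 1) div 4) then 2 * fps_nth psi ((n - 1) div 4 div 2) else 0)"
    proof (cases "even ((n - 1) div 4)")
      case True
      then obtain k where k: "(n - 1) div 4 = 2 * k" by (elim evenE)
      hence "n = 8 * k + 1" using n by presburger
      moreover have "fps_nth theta n = 2 * (fps_nth theta n div 2)" using n(1) by (simp add: theta_nth)
      ultimately show ?thesis using True by (simp add: psi_def)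
    next
      case False
      hence "n mod 8 = 5" using 2 by presburger
      thus ?thesis using False sq[of n] by simp
    qed
    thus ?thesis using n
      by (simp add: fps_nth_compose_X_power numeral_fps_const)
  next
    case 3
    hence "\<not> 4 dvd n" "\<not> 4 dvd n - 1" "n mod 8 \<notin> {0, 1, 4}" by (presburger, presburger, simp, presburger)
    thus ?thesis by (simp add: sq fps_nth_compose_X_power)
  qed
qed

text \<open>
  In the notation of the introduction, \<open>theta4\<close> is \<open>A\<close>, \<open>ratio\<close> is \<open>s\<close> and \<open>ratio4\<close> is \<open>w\<close>.
\<close>

definition half_ratio :: "int fps" where "half_ratio = (psi oo fps_X\<^sup>2) * finv theta"

definition ratio :: "int fps" where "ratio = fps_X * ((2 * half_ratio) oo fps_X ^ 4)"

definition theta4 :: "int fps" where "theta4 = theta oo fps_X ^ 4"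

definition ratio4 :: "int fps" where "ratio4 = fps_X * (2 * half_ratio) ^ 4"

lemma theta_mult_half_ratio: "theta * half_ratio = psi oo fps_X\<^sup>2"
  using mult_finv[of theta] by (simp add: half_ratio_def mult.left_commute)

lemma ratio_nth_0 [simp]: "fps_nth ratio 0 = 0" and ratio4_nth_0 [simp]: "fps_nth ratio4 0 = 0" and theta4_nth_0 [simp]: "fps_nth theta4 0 = 1"
  by (simp_all add: ratio_def ratio4_def theta4_def)

text \<open>Separates \<open>fps_X ^ n\<close> from a series in q^4, so all exponents of A s^n are n
  modulo 4, and exhibits the factor 2^n.\<close>

lemma theta4_mult_ratio_power: "theta4 * ratio ^ n = fps_X ^ n * ((theta * (2 * half_ratio) ^ n) oo fps_X ^ 4)"
  unfolding theta4_def ratio_def power_mult_distrib[of fps_X]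
  by (simp add: fps_compose_power mult.left_commute) (simp add: fps_compose_mult_distrib)

lemma theta4_mult_ratio: "theta4 * ratio = fps_X * (2 * (psi oo fps_X\<^sup>2) oo fps_X ^ 4)"
  using theta4_mult_ratio_power[of 1] unfolding power_one_right mult.left_commute[of theta 2] theta_mult_half_ratio .

lemma theta_eq: "theta = theta4 * (1 + ratio)"
  using theta_dissection by (simp add: distrib_left theta4_mult_ratio) (simp add: theta4_def)

lemma theta_neg_eq: "theta_neg = theta4 * (1 - ratio)"
proof -
  have "theta + theta_neg = 2 * theta4" using theta_compose_uminus_add by (simp add: theta_neg_def theta4_def)
  thus ?thesis by (subst (asm) theta_eq) (simp add: algebra_simps)
qed

section \<open>The quartic relation between \<open>ratio\<close> and \<open>ratio4\<close>\<close>

lemma ratio_power4: "ratio ^ 4 = ratio4 oo fps_X ^ 4"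
  by (simp add: ratio_def ratio4_def power_mult_distrib fps_compose_mult_distrib fps_compose_power)

lemma theta4_nonzero: "theta4 \<noteq> 0"
  using theta4_nth_0 by (metis fps_zero_nth zero_neq_one)

text \<open>2 (1 - s^4) is (1 + s)(1 - s) times (1 + s)^2 + (1 - s)^2. After multiplication by A^4
  these are \<theta>(q) \<theta>(-q) and \<theta>(q)^2 + \<theta>(-q)^2, both known at q^2; their
  product is twice a fourth power in q^4.\<close>

lemma theta_power4_mult_ratio4: "theta ^ 4 * (1 - ratio4) = theta_neg ^ 4"
proof -
  define a where "a = theta oo fps_X\<^sup>2"
  define b where "b = theta_neg oo fps_X\<^sup>2"
  have "2 * (theta4 ^ 4 * (1 - ratio ^ 4)) = (theta * theta_neg) * (theta\<^sup>2 + theta_neg\<^sup>2)"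
    unfolding theta_eq theta_neg_eq by (simp add: power2_eq_square power4_eq_xxxx algebra_simps)
  also have "\<dots> = 2 * (a * b)\<^sup>2"
    using theta_square_add unfolding theta_mult_theta_neg theta_neg_def[symmetric]
    by (simp add: a_def b_def power_mult_distrib mult_ac)
  also have "a * b = (theta * theta_neg) oo fps_X\<^sup>2"
    by (simp add: a_def b_def fps_compose_mult_distrib)
  also have "\<dots> = (theta_neg oo fps_X ^ 4)\<^sup>2"
    unfolding theta_mult_theta_neg by (simp add: fps_compose_power[symmetric] compose_X_squared_twice)
  finally have "(theta ^ 4 * (1 - ratio4)) oo fps_X ^ 4 = theta_neg ^ 4 oo fps_X ^ 4"
    by (simp add: ratio_power4 theta4_def fps_compose_mult_distrib fps_compose_sub_distrib fps_compose_power power_mult[symmetric])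
  thus ?thesis by (rule fps_compose_X_power_inject) simp
qed

definition omega :: "int fps" where
  "omega = fps_X * (1 + fps_X\<^sup>2) * finv ((1 + fps_X) ^ 4)"

lemma omega_nth_0 [simp]: "fps_nth omega 0 = 0"
  by (simp add: omega_def)

text \<open>Dividing \<open>theta_power4_mult_ratio4\<close> by A^4 gives (1 + s)^4 (1 - w) = (1 -
  s)^4, and (1 + s)^4 - (1 - s)^4 = 8 s (1 + s^2).\<close>

lemma ratio4_eq: "ratio4 = 8 * (omega oo ratio)"
proof -
  have "theta4 ^ 4 * ((1 + ratio) ^ 4 * (1 - ratio4)) = theta4 ^ 4 * (1 - ratio) ^ 4"
    using theta_power4_mult_ratio4 unfolding theta_eq theta_neg_eq by (simp add: power_mult_distrib mult_ac)
  hence 1: "(1 + ratio) ^ 4 * (1 - ratio4) = (1 - ratio) ^ 4" using theta4_nonzero by simp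
  have "(1 + ratio) ^ 4 * ratio4 = (1 + ratio) ^ 4 - (1 + ratio) ^ 4 * (1 - ratio4)" by (simp add: algebra_simps)
  also have "\<dots> = 8 * (ratio * (1 + ratio\<^sup>2))" unfolding 1 by (simp add: power2_eq_square power4_eq_xxxx algebra_simps)
  also have "ratio * (1 + ratio\<^sup>2) = (omega * (1 + fps_X) ^ 4) oo ratio"
  proof -
    have "omega * (1 + fps_X) ^ 4 = fps_X * (1 + fps_X\<^sup>2) * ((1 + fps_X) ^ 4 * finv ((1 + fps_X) ^ 4))"
      by (simp add: omega_def mult_ac)
    also have "(1 + fps_X) ^ 4 * finv ((1 + fps_X) ^ 4 :: int fps) = 1"
      by (rule mult_finv) (simp add: fps_nth_power_0)
    finally show ?thesis
      by (simp add: fps_compose_mult_distrib fps_compose_add_distrib fps_X_power_compose)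
  qed
  also have "8 * \<dots> = (1 + ratio) ^ 4 * (8 * (omega oo ratio))"
    by (simp add: fps_compose_mult_distrib fps_compose_add_distrib fps_compose_power[symmetric] mult_ac)
  finally have "(1 + ratio) ^ 4 * ratio4 = (1 + ratio) ^ 4 * (8 * (omega oo ratio))" .
  moreover have "1 + ratio \<noteq> 0" using ratio_nth_0 by (metis add.right_neutral fps_add_nth fps_one_nth fps_zero_nth zero_neq_one)
  ultimately show ?thesis by simp
qed

text \<open>Since \<open>b ^ n\<close> starts at exponent n or later, finitely many terms matter.
  This reduces claims about A P(s) to the single series A s^n.\<close>

lemma fps_nth_mult_compose:
  fixes P b :: "'a::comm_ring_1 fps"
  assumes "fps_nth b 0 = 0"
  shows "fps_nth (a * (P oo b)) N = (\<Sum>n\<le>N. fps_nth P n * fps_nth (a * b ^ n) N)"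
proof -
  have "fps_nth (P oo b) j = (\<Sum>n\<le>N. fps_nth P n * fps_nth (b ^ n) j)" if "j \<le> N" for j
    unfolding fps_compose_nth
    by (rule sum.mono_neutral_left) (use that assms startsby_zero_power_prefix in fastforce)+
  hence "fps_nth (a * (P oo b)) N = (\<Sum>i=0..N. fps_nth a i * (\<Sum>n\<le>N. fps_nth P n * fps_nth (b ^ n) (N - i)))"
    by (simp add: fps_mult_nth)
  also have "\<dots> = (\<Sum>n\<le>N. \<Sum>i=0..N. fps_nth P n * (fps_nth a i * fps_nth (b ^ n) (N - i)))"
    unfolding sum_distrib_left by (subst sum.swap) (simp add: mult_ac)
  finally show ?thesis by (simp add: fps_mult_nth sum_distrib_left)
qed

lemma theta4_mult_ratio_power_nth: "fps_nth (theta4 * ratio ^ n) N =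
    (if n \<le> N \<and> 4 dvd N - n then fps_nth (theta * (2 * half_ratio) ^ n) ((N - n) div 4) else 0)"
  unfolding theta4_mult_ratio_power by (simp add: fps_X_power_mult_nth fps_nth_compose_X_power)

subsection \<open>Iterating the operator U4\<close>

definition U4 :: "int fps \<Rightarrow> int fps" where
  "U4 f = Abs_fps (\<lambda>n. fps_nth f (4 * n))"

text \<open>Only n = 4 j contributes to multiples of 4, and A s^(4 j) is \<theta> w^j taken at
  q^4.\<close>

lemma U4_theta4_mult_compose: "U4 (theta4 * (P oo ratio)) = theta * (U4 P oo ratio4)"
proof (rule fps_ext)
  fix m
  have "fps_nth (U4 (theta4 * (P oo ratio))) m = (\<Sum>n\<le>4 * m. fps_nth P n * fps_nth (theta4 * ratio ^ n) (4 * m))"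
    by (simp add: U4_def fps_nth_mult_compose)
  also have "\<dots> = (\<Sum>n\<in>(*) 4 ` {..m}. fps_nth P n * fps_nth (theta4 * ratio ^ n) (4 * m))"
  proof (rule sum.mono_neutral_right)
    show "\<forall>n\<in>{..4 * m} - (*) 4 ` {..m}. fps_nth P n * fps_nth (theta4 * ratio ^ n) (4 * m) = 0"
    proof
      fix n assume n: "n \<in> {..4 * m} - (*) 4 ` {..m}"
      hence "\<not> 4 dvd n" by (auto elim!: dvdE)
      hence "\<not> 4 dvd 4 * m - n" using n by (metis DiffD1 atMost_iff dvd_diffD1 dvd_triv_left)
      thus "fps_nth P n * fps_nth (theta4 * ratio ^ n) (4 * m) = 0" by (simp add: theta4_mult_ratio_power_nth)
    qed
  qed auto
  also have "\<dots> = (\<Sum>j\<le>m. fps_nth P (4 * j) * fps_nth (theta * ratio4 ^ j) m)"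
  proof (subst sum.reindex)
    have "fps_nth (theta4 * ratio ^ (4 * j)) (4 * m) = fps_nth (theta * ratio4 ^ j) m" if "j \<le> m" for j
    proof -
      define h where "h = theta * (2 * half_ratio) ^ (4 * j)"
      have "theta * ratio4 ^ j = fps_X ^ j * h" unfolding h_def
        unfolding ratio4_def power_mult_distrib[of fps_X] power_mult by (rule mult.left_commute)
      thus ?thesis using that
        unfolding theta4_mult_ratio_power_nth h_def[symmetric]
        by (simp add: fps_X_power_mult_nth flip: diff_mult_distrib2)
    qed
    thus "sum ((\<lambda>n. fps_nth P n * fps_nth (theta4 * ratio ^ n) (4 * m)) \<circ> (*) 4) {..m}
        = (\<Sum>j\<le>m. fps_nth P (4 * j) * fps_nth (theta * ratio4 ^ j) m)" by simp
  qed (simp add: inj_on_def)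
  also have "\<dots> = fps_nth (theta * (U4 P oo ratio4)) m"
    by (simp add: fps_nth_mult_compose U4_def)
  finally show "fps_nth (U4 (theta4 * (P oo ratio))) m = fps_nth (theta * (U4 P oo ratio4)) m" .
qed

text \<open>(1 + x)^2 / (1 - x) = 1 + 3 x + 4 x^2 / (1 - x): from x^2 on, all coefficients are
  4.\<close>

lemma v0_quad_eq: "v0_quad = theta4 * ((1 + 3 * fps_X + 4 * (fps_X\<^sup>2 * finv (1 - fps_X))) oo ratio)"
proof -
  define D :: "int fps" where "D = 1 + 3 * fps_X + 4 * (fps_X\<^sup>2 * finv (1 - fps_X))"
  have "(1 - fps_X) * finv (1 - fps_X) = (1 :: int fps)" by (rule mult_finv) simp
  hence "(1 - fps_X) * D = (1 - fps_X) * (1 + 3 * fps_X) + 4 * fps_X\<^sup>2"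
    by (simp add: D_def distrib_left mult.left_commute)
  also have "\<dots> = (1 + fps_X)\<^sup>2" by (simp add: power2_eq_square algebra_simps)
  finally have "((1 - fps_X) * D) oo ratio = (1 + fps_X)\<^sup>2 oo ratio" by simp
  hence D: "(1 - ratio) * (D oo ratio) = (1 + ratio)\<^sup>2"
    by (simp add: fps_compose_mult_distrib fps_compose_sub_distrib fps_compose_add_distrib fps_compose_power[symmetric])
  have "v0_quad * theta_neg = theta4\<^sup>2 * ((1 - ratio) * (D oo ratio))"
    unfolding v0_quad_mult_theta_neg D by (simp add: theta_eq power_mult_distrib)
  also have "\<dots> = theta4 * (D oo ratio) * theta_neg"
    unfolding theta_neg_eq by (simp add: power2_eq_square mult_ac)
  finally show ?thesis
    using theta_neg_nth_0 unfolding D_def[symmetric] by (metis fps_zero_nth mult_cancel_right zero_neq_one)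
qed

text \<open>\<open>P\<close> has no constant term, so P(w) contains a factor w = 8 \<omega>(s); this
  is the gain of 8 per iteration. The leading 1 + \<open>fps_X\<close> comes from \<theta> = A (1 +
  s).\<close>

lemma theta_mult_ratio4_compose:
  assumes "fps_nth P 0 = 0"
  obtains Q where "fps_nth Q 0 = 0"
    "theta * (1 + fps_const c * (P oo ratio4)) = theta4 * ((1 + fps_X + fps_const (8 * c) * Q) oo ratio)"
proof
  define P1 where "P1 = fps_shift 1 P"
  define Q where "Q = (1 + fps_X) * (omega * (P1 oo (8 * omega)))"
  show "fps_nth Q 0 = 0" by (simp add: Q_def)
  have "P = fps_X * P1" unfolding P1_def by (rule fps_ext) (use assms in auto)
  hence 1: "P oo ratio4 = ratio4 * (P1 oo ratio4)"
    by (simp add: fps_compose_mult_distrib)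
  have 2: "P1 oo ratio4 = (P1 oo (8 * omega)) oo ratio"
    by (subst fps_compose_assoc[symmetric]) (simp_all add: ratio4_eq fps_compose_mult_distrib)
  have Pw: "P oo ratio4 = 8 * ((omega * (P1 oo (8 * omega))) oo ratio)"
    unfolding 1 2 by (subst ratio4_eq) (simp add: fps_compose_mult_distrib mult.assoc)
  have 8: "8 = fps_const (8 :: int)" by (simp add: numeral_fps_const)
  have "fps_const c * 8 = fps_const (8 * c)" unfolding 8 by (simp add: mult.commute)
  hence "fps_const c * (P oo ratio4) = fps_const (8 * c) * ((omega * (P1 oo (8 * omega))) oo ratio)"
    unfolding Pw by (simp only: mult.assoc[symmetric])
  thus "theta * (1 + fps_const c * (P oo ratio4)) = theta4 * ((1 + fps_X + fps_const (8 * c) * Q) oo ratio)"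
    unfolding Q_def theta_eq
    by (simp add: fps_compose_mult_distrib fps_compose_add_distrib) (simp add: algebra_simps)
qed

lemma U4_add: "U4 (f + h) = U4 f + U4 h" and U4_const_mult: "U4 (fps_const c * f) = fps_const c * U4 f"
  by (rule fps_ext; simp add: U4_def)+

lemma U4_1: "U4 1 = 1" and U4_X: "U4 fps_X = 0"
  by (rule fps_ext; simp add: U4_def)+

lemma U4_nth: "fps_nth (U4 f) n = fps_nth f (4 * n)"
  by (simp add: U4_def)

text \<open>The initial exponent 2 is the factor 4 in \<open>v0_quad_eq\<close>. \<open>U4\<close>
  fixes 1 and kills \<open>fps_X\<close>, so only the part with the growing power of 2
  changes.\<close>

lemma U4_power_v0_quad: "\<exists>P. fps_nth P 0 = 0 \<and> (U4 ^^ Suc \<alpha>) v0_quad = theta * (1 + fps_const (2 ^ (3 * \<alpha> + 2)) * (P oo ratio4))"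
proof (induction \<alpha>)
  case 0
  define E :: "int fps" where "E = fps_X\<^sup>2 * finv (1 - fps_X)"
  have 34: "3 = fps_const (3 :: int)" "4 = fps_const (4 :: int)" by (simp_all add: numeral_fps_const)
  have "U4 v0_quad = theta * (U4 (1 + fps_const 3 * fps_X + fps_const 4 * E) oo ratio4)"
    unfolding v0_quad_eq E_def[symmetric] 34 by (rule U4_theta4_mult_compose)
  also have "U4 (1 + fps_const 3 * fps_X + fps_const 4 * E) = 1 + fps_const 4 * U4 E"
    by (simp add: U4_add U4_const_mult U4_1 U4_X)
  also have "\<dots> oo ratio4 = 1 + fps_const 4 * (U4 E oo ratio4)"
    by (simp add: fps_compose_add_distrib fps_compose_mult_distrib)
  finally have "U4 v0_quad = theta * (1 + fps_const 4 * (U4 E oo ratio4))" .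
  moreover have "fps_nth (U4 E) 0 = 0" by (simp add: U4_nth E_def)
  ultimately show ?case by (intro exI[of _ "U4 E"]) simp
next
  case (Suc \<alpha>)
  then obtain P where P: "fps_nth P 0 = 0"
    "(U4 ^^ Suc \<alpha>) v0_quad = theta * (1 + fps_const (2 ^ (3 * \<alpha> + 2)) * (P oo ratio4))" by blast
  obtain Q where Q: "fps_nth Q 0 = 0" "(U4 ^^ Suc \<alpha>) v0_quad = theta4 * ((1 + fps_X + fps_const (8 * 2 ^ (3 * \<alpha> + 2)) * Q) oo ratio)"
    using theta_mult_ratio4_compose[OF P(1)] unfolding P(2) by blast
  have "(U4 ^^ Suc (Suc \<alpha>)) v0_quad = U4 ((U4 ^^ Suc \<alpha>) v0_quad)" by simp
  also have "\<dots> = theta * (U4 (1 + fps_X + fps_const (8 * 2 ^ (3 * \<alpha> + 2)) * Q) oo ratio4)"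
    unfolding Q(2) by (rule U4_theta4_mult_compose)
  also have "U4 (1 + fps_X + fps_const (8 * 2 ^ (3 * \<alpha> + 2)) * Q) = 1 + fps_const (8 * 2 ^ (3 * \<alpha> + 2)) * U4 Q"
    by (simp only: U4_add U4_const_mult U4_1 U4_X add_0_right)
  also have "\<dots> oo ratio4 = 1 + fps_const (2 ^ (3 * Suc \<alpha> + 2)) * (U4 Q oo ratio4)"
    by (simp add: fps_compose_add_distrib fps_compose_mult_distrib power_add)
  finally show ?case using Q(1) by (intro exI[of _ "U4 Q"]) (simp add: U4_nth)
qed

subsection \<open>Divisibility of the coefficients\<close>

text \<open>\<open>theta\<close> is 1 modulo 2, so its square is 1 modulo 4 and its fourth power 1
  modulo 8; the inverse inherits this.\<close>

lemma finv_theta_power4: "\<exists>e. finv theta ^ 4 = 1 + 8 * e"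
proof -
  define t where "t = Abs_fps (\<lambda>n. fps_nth (theta - 1) n div 2)"
  have theta: "theta = 1 + 2 * t"
    by (rule fps_ext) (auto simp: t_def theta_nth numeral_fps_const)
  have "(1 + 2 * t)\<^sup>2 = 1 + 4 * (t + t\<^sup>2)" by (simp add: power2_eq_square algebra_simps)
  moreover have "(1 + 4 * v)\<^sup>2 = 1 + 8 * (v + 2 * v\<^sup>2)" for v :: "int fps"
    by (simp add: power2_eq_square algebra_simps)
  moreover have "theta ^ 4 = (theta\<^sup>2)\<^sup>2" by simp
  ultimately obtain h where h: "theta ^ 4 = 1 + 8 * h" using theta by metis
  have "theta * finv theta = 1" by (rule mult_finv) simp
  hence "finv theta ^ 4 * theta ^ 4 = 1" by (metis mult.commute power_mult_distrib power_one)
  hence "finv theta ^ 4 = 1 + 8 * (- h * finv theta ^ 4)" by (simp add: h algebra_simps)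
  thus ?thesis by blast
qed

text \<open>Only A s^n with n = 1 modulo 4 reaches m. For n = 1 the coefficient is that of 2 q
  \<psi>(q^8), zero at a nonsquare; n = 5 gives 2^5 times 8, and n \<ge> 9 gives at least
  2^9.\<close>

lemma theta4_mult_compose_nth_dvd:
  assumes m: "m mod 8 = 1" "\<And>k. m \<noteq> k\<^sup>2"
  shows "2 ^ 8 dvd fps_nth (theta4 * (P oo ratio)) m"
proof -
  have "2 ^ 8 dvd fps_nth (theta4 * ratio ^ n) m" for n
  proof (cases "n \<le> m \<and> 4 dvd m - n")
    case False
    thus ?thesis by (simp only: theta4_mult_ratio_power_nth if_False dvd_0_right)
  next
    case True
    obtain l where l: "m = 8 * l + 1" using m(1) by (metis mod_eqE mult_div_mod_eq)
    have n: "n mod 4 = 1" using True m(1) by presburger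
    have An: "fps_nth (theta4 * ratio ^ n) m = 2 ^ n * fps_nth (theta * half_ratio ^ n) ((m - n) div 4)"
    proof -
      have "theta * (2 * half_ratio) ^ n = fps_const (2 ^ n) * (theta * half_ratio ^ n)"
        by (simp add: power_mult_distrib numeral_fps_const fps_const_power mult_ac)
      thus ?thesis using True by (simp only: theta4_mult_ratio_power_nth if_True simp_thms fps_mult_left_const_nth)
    qed
    have "n = 1 \<or> n = 5 \<or> n \<ge> 9" using n by presburger
    then consider "n = 1" | "n = 5" | "n \<ge> 9" by blast
    thus ?thesis
    proof cases
      case 1
      have "fps_nth (theta * half_ratio ^ n) ((m - n) div 4) = fps_nth psi l"
        using 1 by (simp add: theta_mult_half_ratio l fps_nth_compose_X_power)
      also have "\<dots> = 0" using m(2) by (auto simp: psi_def theta_nth l)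
      finally show ?thesis by (simp add: An)
    next
      \<comment> \<open>Here \<open>2 ^ n\<close> only gives \<open>2 ^ 5\<close>; the missing 8 comes from \<open>theta ^ 4 = 1\<close> modulo 8.\<close>
      case 2
      obtain e where e: "finv theta ^ 4 = 1 + 8 * e" using finv_theta_power4 by blast
      have "theta * half_ratio ^ n = (theta * finv theta) * (psi oo fps_X\<^sup>2) ^ 5 * finv theta ^ 4"
        unfolding 2 half_ratio_def by (simp add: power_mult_distrib eval_nat_numeral mult_ac)
      also have "theta * finv theta = 1" by (rule mult_finv) simp
      finally have "theta * half_ratio ^ n = (psi ^ 5 oo fps_X\<^sup>2) + fps_const 8 * ((psi oo fps_X\<^sup>2) ^ 5 * e)"
        by (simp add: e fps_compose_power numeral_fps_const algebra_simps)
      \<comment> \<open>For m = 8 l + 1 this is 2 l - 1, so the series in q^2 contributes nothing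
        and only the multiple of 8 remains.\<close>
      moreover have "odd ((m - n) div 4)" using True unfolding l 2 by presburger
      ultimately have "fps_nth (theta * half_ratio ^ n) ((m - n) div 4) = 8 * fps_nth ((psi oo fps_X\<^sup>2) ^ 5 * e) ((m - n) div 4)"
        by (simp add: fps_nth_compose_X_power)
      thus ?thesis unfolding An by (simp add: 2)
    next
      case 3
      thus ?thesis unfolding An by (intro dvd_mult2 le_imp_power_dvd) simp
    qed
  qed
  thus ?thesis by (simp add: fps_nth_mult_compose dvd_sum)
qed

lemma theta_nth_nonsquare: "(\<And>k. m \<noteq> k\<^sup>2) \<Longrightarrow> fps_nth theta m = 0"
  using theta_nth[of m] by (metis power_zero_numeral)

lemma U4_power_nth: "fps_nth ((U4 ^^ \<alpha>) f) m = fps_nth f (4 ^ \<alpha> * m)"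
  by (induction \<alpha> arbitrary: m) (simp_all add: U4_nth mult_ac)

text \<open>For \<alpha> = 0 the exponent is 2 + 8, from the factor 4 and the previous divisibility.
  For \<alpha> = \<beta> + 1 it is (3 \<beta> + 2) + 3 + 8, since \<theta> itself vanishes at
  m.\<close>

lemma v0_quad_nth_dvd:
  assumes m: "m mod 8 = 1" "\<And>k. m \<noteq> k\<^sup>2"
  shows "2 ^ (3 * \<alpha> + 10) dvd fps_nth v0_quad (4 ^ \<alpha> * m)"
proof (cases \<alpha>)
  case 0
  define E :: "int fps" where "E = fps_X\<^sup>2 * finv (1 - fps_X)"
  \<comment> \<open>\<open>theta4 * ratio\<close> occurs with coefficient 3, so the vanishing of
    \<theta> = A + A s at m does not suffice. But A is a series in q^4 and m is odd, so both parts
    vanish.\<close>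
  have "fps_nth theta4 m = 0" using m(1) by (auto simp: theta4_def fps_nth_compose_X_power) presburger
  moreover have "fps_nth theta4 m + fps_nth (theta4 * ratio) m = 0"
    using theta_nth_nonsquare[OF m(2)] unfolding theta_eq by (simp add: distrib_left)
  moreover have Feq: "v0_quad = theta4 + fps_const 3 * (theta4 * ratio) + fps_const 4 * (theta4 * (E oo ratio))"
    unfolding v0_quad_eq E_def
    by (simp add: fps_compose_add_distrib fps_compose_mult_distrib distrib_left numeral_fps_const mult_ac)
  ultimately have "fps_nth v0_quad m = 4 * fps_nth (theta4 * (E oo ratio)) m"
    unfolding Feq by simp
  moreover have "2 ^ 8 dvd fps_nth (theta4 * (E oo ratio)) m" by (rule theta4_mult_compose_nth_dvd[OF m])
  hence "4 * 2 ^ 8 dvd 4 * fps_nth (theta4 * (E oo ratio)) m" by (rule mult_dvd_mono[OF dvd_refl])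
  ultimately show ?thesis by (simp add: 0)
next
  case (Suc \<beta>)
  obtain P where P: "fps_nth P 0 = 0"
    "(U4 ^^ Suc \<beta>) v0_quad = theta * (1 + fps_const (2 ^ (3 * \<beta> + 2)) * (P oo ratio4))" using U4_power_v0_quad by blast
  define c :: int where "c = 8 * 2 ^ (3 * \<beta> + 2)"
  obtain Q where Q: "(U4 ^^ Suc \<beta>) v0_quad = theta4 * ((1 + fps_X + fps_const c * Q) oo ratio)"
    using theta_mult_ratio4_compose[OF P(1)] unfolding P(2) c_def by blast
  have "theta4 * ((1 + fps_X + fps_const c * Q) oo ratio) = theta + fps_const c * (theta4 * (Q oo ratio))"
    unfolding theta_eq
    by (simp add: fps_compose_add_distrib fps_compose_mult_distrib distrib_left mult_ac)
  hence "fps_nth v0_quad (4 ^ \<alpha> * m) = fps_nth theta m + c * fps_nth (theta4 * (Q oo ratio)) m"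
    unfolding Suc U4_power_nth[symmetric] Q by simp
  also have "\<dots> = c * fps_nth (theta4 * (Q oo ratio)) m" using theta_nth_nonsquare[OF m(2)] by simp
  finally have "fps_nth v0_quad (4 ^ \<alpha> * m) = c * fps_nth (theta4 * (Q oo ratio)) m" .
  moreover have "c * 2 ^ 8 dvd c * fps_nth (theta4 * (Q oo ratio)) m"
    by (rule mult_dvd_mono[OF dvd_refl theta4_mult_compose_nth_dvd[OF m]])
  moreover have "c * 2 ^ 8 = 2 ^ (3 * \<alpha> + 10)" by (simp add: c_def Suc power_add)
  ultimately show ?thesis by (simp only:)
qed

text \<open>The factor 2 in \<open>v0_quad\<close> costs one power of 2; its correction at index 0
  is avoided as m is nonzero.\<close>

lemma v0_dvd:
  assumes m: "m mod 8 = 1" "\<And>k. m \<noteq> k\<^sup>2"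
  shows "2 ^ (3 * \<alpha> + 9) dvd v0 (2 ^ (2 * \<alpha> + 2) * m)"
proof -
  have "4 ^ \<alpha> * m \<noteq> 0" using m(1) by (cases m) auto
  hence "fps_nth v0_quad (4 ^ \<alpha> * m) = 2 * v0 (4 * (4 ^ \<alpha> * m))" unfolding v0_quad_def by simp
  also have "4 * (4 ^ \<alpha> * m) = 2 ^ (2 * \<alpha> + 2) * m" by (simp add: power_add power_mult)
  finally have "2 ^ (3 * \<alpha> + 10) dvd 2 * v0 (2 ^ (2 * \<alpha> + 2) * m)"
    using v0_quad_nth_dvd[OF m, of \<alpha>] by (simp only:)
  moreover have "(2::int) ^ (3 * \<alpha> + 10) = 2 * 2 ^ (3 * \<alpha> + 9)" by (simp add: power_add)
  ultimately show ?thesis by (simp only: dvd_mult_cancel_left) simp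
qed

text \<open>In both families the argument is 2^(2 \<alpha> + 2) m, where m is 1 modulo 8 because odd
  squares are, and m is not a square; then \<open>v0_dvd\<close> applies.\<close>

theorem corollary1p2:
  fixes n \<alpha> \<beta> p :: nat
  assumes "prime p" and "odd p"
  shows "(\<forall>i\<in>{1..p - 1}.
            [v0 (2 ^ (2 * \<alpha> + 2) * p ^ (2 * \<beta> + 1) * (8 * p * n + 8 * i + p)) = 0]
              (mod 2 ^ (3 * \<alpha> + 9))) \<and>
         (\<forall>j\<in>{0..p - 1}. Legendre (int (8 * j + 1)) (int p) = -1 \<longrightarrow>
            [v0 (2 ^ (2 * \<alpha> + 2) * p ^ (2 * \<beta>) * (8 * p * n + 8 * j + 1)) = 0]
              (mod 2 ^ (3 * \<alpha> + 9)))"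
proof (intro conjI ballI impI)
  have odd_square: "q\<^sup>2 mod 8 = 1" if "odd q" for q :: nat
  proof -
    have "odd (q\<^sup>2)" using that by simp
    moreover have "odd x \<Longrightarrow> odd (x mod 8)" for x :: nat by presburger
    ultimately have "odd (q\<^sup>2 mod 8)" by blast
    thus ?thesis using square_mod_8[of q] by auto
  qed
  have p_sq: "p ^ (2 * k) mod 8 = 1" for k
    using odd_square[OF \<open>odd p\<close>] by (metis mod_mod_trivial power_mod power_mult power_one mod_less one_less_numeral_iff semiring_norm(76))
  show "[v0 (2 ^ (2 * \<alpha> + 2) * p ^ (2 * \<beta> + 1) * (8 * p * n + 8 * i + p)) = 0] (mod 2 ^ (3 * \<alpha> + 9))"
    if i: "i \<in> {1..p - 1}" for i
  proof -
    define l where "l = 8 * p * n + 8 * i + p"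
    have "\<not> p dvd l"
    proof
      assume "p dvd l"
      moreover have "l = p * (8 * n + 1) + 8 * i" by (simp add: l_def algebra_simps)
      ultimately have "p dvd 8 * i" by (metis dvd_add_right_iff dvd_triv_left)
      moreover have "\<not> p dvd i" using i by (auto dest: dvd_imp_le)
      moreover have "\<not> p dvd 2 ^ 3"
        using \<open>prime p\<close> \<open>odd p\<close> by (metis prime_dvd_power primes_dvd_imp_eq two_is_prime_nat even_numeral dvd_refl)
      ultimately show False using \<open>prime p\<close> by (simp add: prime_dvd_mult_iff)
    qed
    have "p ^ (2 * \<beta> + 1) * l mod 8 = 1"
    proof -
      have "p ^ (2 * \<beta> + 1) * l = p ^ (2 * (\<beta> + 1)) + 8 * (p ^ (2 * \<beta> + 1) * (p * n + i))"
        by (simp add: l_def algebra_simps)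
      thus ?thesis using p_sq[of "\<beta> + 1"] by (simp only: mod_mult_self2)
    qed
    \<comment> \<open>As p does not divide l, its multiplicity is 2 \<beta> + 1, which is
      odd.\<close>
    moreover have "p ^ (2 * \<beta> + 1) * l \<noteq> k\<^sup>2" for k
    proof
      assume k: "p ^ (2 * \<beta> + 1) * l = k\<^sup>2"
      have "l \<noteq> 0" using i by (simp add: l_def)
      hence "multiplicity p (p ^ (2 * \<beta> + 1) * l) = 2 * \<beta> + 1"
        using \<open>\<not> p dvd l\<close> \<open>prime p\<close>
        by (simp add: prime_elem_multiplicity_mult_distrib prime_gt_0_nat not_dvd_imp_multiplicity_0
            del: power_Suc power_add)
      moreover have "multiplicity p (k\<^sup>2) = 2 * multiplicity p k"
      proof -
        have "k \<noteq> 0" using k \<open>l \<noteq> 0\<close> \<open>prime p\<close> by (metis mult_is_0 power_eq_0_iff not_prime_0 zero_power2)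
        thus ?thesis using \<open>prime p\<close> by (simp add: prime_elem_multiplicity_power_distrib)
      qed
      ultimately have "2 * \<beta> + 1 = 2 * multiplicity p k" using k by (simp only:)
      thus False by presburger
    qed
    ultimately show ?thesis
      unfolding l_def[symmetric] mult.assoc[of "2 ^ (2 * \<alpha> + 2)"] cong_0_iff by (rule v0_dvd)
  qed
  show "[v0 (2 ^ (2 * \<alpha> + 2) * p ^ (2 * \<beta>) * (8 * p * n + 8 * j + 1)) = 0] (mod 2 ^ (3 * \<alpha> + 9))"
    if j: "Legendre (int (8 * j + 1)) (int p) = -1" for j
  proof -
    define l where "l = 8 * p * n + 8 * j + 1"
    have "p ^ (2 * \<beta>) * l mod 8 = 1"
    proof -
      have "p ^ (2 * \<beta>) * l = p ^ (2 * \<beta>) + 8 * (p ^ (2 * \<beta>) * (p * n + j))"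
        by (simp add: l_def algebra_simps)
      thus ?thesis using p_sq[of \<beta>] by (simp only: mod_mult_self2)
    qed
    \<comment> \<open>Cancelling the square \<open>p ^ (2 * \<beta>)\<close> would make l a square,
      and l is 8 j + 1 modulo p, a nonresidue.\<close>
    moreover have "p ^ (2 * \<beta>) * l \<noteq> k\<^sup>2" for k
    proof
      assume k: "p ^ (2 * \<beta>) * l = k\<^sup>2"
      hence "(p ^ \<beta>)\<^sup>2 dvd k\<^sup>2" by (metis dvd_triv_left power_mult mult.commute)
      hence "p ^ \<beta> dvd k" by (simp add: pow_divides_pow_iff)
      then obtain c where "k = p ^ \<beta> * c" by (elim dvdE)
      hence "l = c\<^sup>2" using k \<open>prime p\<close>
        by (simp add: power_mult_distrib power_mult[symmetric] mult.commute prime_gt_0_nat)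
      hence "int c ^ 2 = int l" by simp
      also have "\<dots> = int (8 * j + 1) + int p * (8 * int n)" by (simp add: l_def)
      finally have "int c ^ 2 = int (8 * j + 1) + int p * (8 * int n)" .
      hence "[int c ^ 2 = int (8 * j + 1)] (mod int p)" by (simp add: cong_def)
      hence "QuadRes (int p) (int (8 * j + 1))" unfolding QuadRes_def by blast
      thus False using j by (simp add: Legendre_def split: if_splits)
    qed
    ultimately show ?thesis
      unfolding l_def[symmetric] mult.assoc[of "2 ^ (2 * \<alpha> + 2)"] cong_0_iff by (rule v0_dvd)
  qed
qed

end
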